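(* Let $\alpha=\alpha(x,y,z,p,q)$ be a smooth function of involutive type and of non-generic type, let $\mathcal I=\{dz-p\,dx-q\,dy,\ dp-\alpha\,dq\}_{\mathrm{diff}}$, let $\tilde{\mathcal I}$ be the reduced exterior differential system on the leaf space $J^1(2,1)/\mathrm{Ch}(\mathcal I)$, let $\pi\colon J^1(2,1)\to J^1(2,1)/\mathrm{Ch}(\mathcal I)$ be the projection, and let $p_0\in J^1(2,1)$. Then: (1) $\tilde{\mathcal I}$ is of type $(2,3)$ at $\pi(p_0)$ if and only if $\alpha_p+x\alpha_z=0$ at $p_0$. (2) $\tilde{\mathcal I}$ is of type $(2,3,4)$ at $\pi(p_0)$ if and only if $\alpha_p+x\alpha_z\neq0$ at $p_0$.
   Context: All objects are $C^\infty$ and all considerations are local. $J^1(2,1)=PT^*J^0(2,1)$, where $J^0(2,1)$ is a three-dimensional manifold, with canonical local coordinates $(x,y,z,p,q)$ in which the contact form is $\omega_0=dz-p\,dx-q\,dy$. $\{\omega_1,\dots,\omega_r\}_{\mathrm{diff}}$ denotes the ideal of differential forms generated by the $\omega_i$ and $d\omega_i$. $\alpha$ is of involutive type if $\alpha_x+p\alpha_z-\alpha(\alpha_y+q\alpha_z)=0$ on its domain, and of non-generic type if $1+x(\alpha_y+q\alpha_z)=0$ on its domain (so $x\ne0$ there). $\mathrm{Ch}(\mathcal I)=\{X\in TJ^1(2,1):\iota_X(\mathcal I)\subset\mathcal I\}$ is the Cauchy characteristic system; for involutive $\alpha$ it is an integrable line field, and for non-generic $\alpha$ its (local) leaf space $J^1(2,1)/\mathrm{Ch}(\mathcal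 I)$ is a four-dimensional manifold $U_2$ with coordinates $$x_1=\alpha,\quad x_2=z-px-qy,\quad x_3=p,\quad x_4=q,$$ and $\pi(x,y,z,p,q)=(x_1,x_2,x_3,x_4)$. The function $\beta=y+\alpha x$ is constant along the leaves, so $\beta=\overline\beta\circ\pi$ for a function $\overline\beta$ on $U_2$. The reduced system $\tilde{\mathcal I}$ (characterised by $\mathcal I=\{\pi^*\tilde{\mathcal I}\}_{\mathrm{alg}}$, the ideal generated by $\pi^*\tilde{\mathcal I}$) is $$\tilde{\mathcal I}=\{dx_2+\overline\beta\,dx_4,\ dx_3-x_1dx_4\}_{\mathrm{diff}}.$$ Derived type. For a Pfaffian system generated (differentially) by local sections of a subbundle $J\subset T^*M$, the map $\theta\mapsto d\theta \bmod J$ induces a bundle map $\delta'\colon J\to\bigwedge^2(T^*M/J)$; put $J^{(1)}=\mathrm{Ker}\,\delta'$ (the first derived system), and inductively $J^{(k)}=(J^{(k-1)})^{(1)}$ when $J^{(k-1)}$ is a subbundle. If $N$ is the smallest integer with $J^{(N)}=J^{(N+1)}$, the system is of type $(\mathrm{corank}\,J,\mathrm{corank}\,J^{(1)},\dots,\mathrm{corank}\,J^{(N)})$, where $\mathrm{corank}=\dim M-\mathrm{rank}$. "Of type $(\dots)$ at a point $m$" refers to the fibres at $m$: the kernels, their coranks and the stabilisation $J^{(N)}_m=J^{(N+1)}_m$ are taken at $m$. *)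

theory Defs
  imports "HOL-Analysis.Analysis"
begin

section \<open>Smooth maps\<close>

text \<open>On an open set \<open>U\<close>, and for a finite-dimensional domain, \<open>Ck_on k f U\<close> says that \<open>f\<close> is
  \<open>k\<close> times continuously differentiable on \<open>U\<close>.\<close>

fun Ck_on :: "nat \<Rightarrow> ('a::real_normed_vector \<Rightarrow> 'b::real_normed_vector) \<Rightarrow> 'a set \<Rightarrow> bool" where
  "Ck_on 0 f U \<longleftrightarrow> continuous_on U f"
| "Ck_on (Suc k) f U \<longleftrightarrow>
     (\<forall>x\<in>U. f differentiable at x) \<and> (\<forall>v. Ck_on k (\<lambda>x. frechet_derivative f (at x) v) U)"

definition smooth_on :: "'a set \<Rightarrow> ('a::real_normed_vector \<Rightarrow> 'b::real_normed_vector) \<Rightarrow> bool" where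
  "smooth_on U f \<longleftrightarrow> (\<forall>k. Ck_on k f U)"

section \<open>Differential forms\<close>

text \<open>An element of the exterior algebra of the dual of \<open>'a\<close> is a function \<open>w\<close> on lists of vectors:
  its component of degree \<open>k\<close> is the restriction of \<open>w\<close> to lists of length \<open>k\<close>. A (possibly
  inhomogeneous) form on an open set \<open>U\<close> is a smooth field of such elements; it is set to \<open>0\<close>
  outside \<open>U\<close>, so that equality of forms on \<open>U\<close> is equality in HOL.\<close>

type_synonym 'a form = "'a \<Rightarrow> 'a list \<Rightarrow> real"

definition alternating :: "('a::real_vector list \<Rightarrow> real) \<Rightarrow> bool" where
  "alternating w \<longleftrightarrow>
     (\<forall>xs ys. linear (\<lambda>v. w (xs @ v # ys))) \<and>
     (\<forall>xs ys zs v. w (xs @ v # ys @ v # zs) = 0)"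

definition forms :: "'a::euclidean_space set \<Rightarrow> 'a form set" where
  "forms U = {\<omega>. (\<forall>x\<in>U. alternating (\<omega> x)) \<and> (\<forall>vs. smooth_on U (\<lambda>x. \<omega> x vs)) \<and>
                 (\<forall>x. x \<notin> U \<longrightarrow> \<omega> x = (\<lambda>_. 0))}"

text \<open>The exterior product, defined through the antiderivation rule
  \<open>\<iota>\<^sub>v (w \<and> w') = (\<iota>\<^sub>v w) \<and> w' + (grade involution of w) \<and> (\<iota>\<^sub>v w')\<close>; this is the shuffle
  convention, without factorials.\<close>

fun wedge :: "('a list \<Rightarrow> real) \<Rightarrow> ('a list \<Rightarrow> real) \<Rightarrow> 'a list \<Rightarrow> real" where
  "wedge w w' [] = w [] * w' []"
| "wedge w w' (v # vs) =
     wedge (\<lambda>us. w (v # us)) w' vs + wedge (\<lambda>us. (- 1) ^ length us * w us) (\<lambda>us. w' (v # us)) vs"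

definition form_wedge :: "'a form \<Rightarrow> 'a form \<Rightarrow> 'a form" where
  "form_wedge \<omega> \<eta> = (\<lambda>x. wedge (\<omega> x) (\<eta> x))"

definition ext_d :: "'a::euclidean_space set \<Rightarrow> 'a form \<Rightarrow> 'a form" where
  "ext_d U \<omega> = (\<lambda>x vs. if x \<in> U then
     (\<Sum>i<length vs. (- 1) ^ i *
        frechet_derivative (\<lambda>y. \<omega> y (take i vs @ drop (Suc i) vs)) (at x) (vs ! i)) else 0)"

definition interior_product :: "('a \<Rightarrow> 'a) \<Rightarrow> 'a form \<Rightarrow> 'a form" where
  "interior_product X \<omega> = (\<lambda>x vs. \<omega> x (X x # vs))"

definition pullback ::
    "'a::real_normed_vector set \<Rightarrow> ('a \<Rightarrow> 'b::real_normed_vector) \<Rightarrow> 'b form \<Rightarrow> 'a form" where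
  "pullback U f \<omega> =
     (\<lambda>x vs. if x \<in> U then \<omega> (f x) (map (frechet_derivative f (at x)) vs) else 0)"

text \<open>Covectors are elements of \<open>'a \<Rightarrow>\<^sub>L real\<close>, and 1-forms are often given as smooth covector fields.\<close>

definition covector :: "('a::real_normed_vector \<Rightarrow>\<^sub>L real) \<Rightarrow> 'a list \<Rightarrow> real" where
  "covector e vs = (case vs of [v] \<Rightarrow> blinfun_apply e v | _ \<Rightarrow> 0)"

definition one_form :: "'a set \<Rightarrow> ('a::real_normed_vector \<Rightarrow> 'a \<Rightarrow>\<^sub>L real) \<Rightarrow> 'a form" where
  "one_form U \<theta> = (\<lambda>x vs. if x \<in> U then covector (\<theta> x) vs else 0)"

section \<open>Ideals, Cauchy characteristics and leaves\<close>

inductive_set alg_ideal :: "'a::euclidean_space set \<Rightarrow> 'a form set \<Rightarrow> 'a form set"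
  for U :: "'a set" and G :: "'a form set" where
  zero: "(\<lambda>_ _. 0) \<in> alg_ideal U G"
| gen: "\<omega> \<in> G \<Longrightarrow> \<omega> \<in> alg_ideal U G"
| add: "\<omega> \<in> alg_ideal U G \<Longrightarrow> \<eta> \<in> alg_ideal U G \<Longrightarrow> (\<lambda>x vs. \<omega> x vs + \<eta> x vs) \<in> alg_ideal U G"
| mult_left: "\<omega> \<in> forms U \<Longrightarrow> \<eta> \<in> alg_ideal U G \<Longrightarrow> form_wedge \<omega> \<eta> \<in> alg_ideal U G"
| mult_right: "\<omega> \<in> forms U \<Longrightarrow> \<eta> \<in> alg_ideal U G \<Longrightarrow> form_wedge \<eta> \<omega> \<in> alg_ideal U G"

definition diff_ideal :: "'a::euclidean_space set \<Rightarrow> 'a form set \<Rightarrow> 'a form set" where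
  "diff_ideal U G = alg_ideal U (G \<union> ext_d U ` G)"

definition pfaffian_system :: "'a::euclidean_space set \<Rightarrow> 'a form set \<Rightarrow> bool" where
  "pfaffian_system U I \<longleftrightarrow>
     (\<exists>G. finite G \<and> (\<forall>\<theta>\<in>G. smooth_on U \<theta>) \<and> I = diff_ideal U (one_form U ` G))"

text \<open>The fibre at \<open>a\<close> of the Cauchy characteristic system of \<open>I\<close>.\<close>

definition cauchy_char :: "'a::euclidean_space set \<Rightarrow> 'a form set \<Rightarrow> 'a \<Rightarrow> 'a set" where
  "cauchy_char U I a = {X a | X. smooth_on U X \<and> (\<forall>\<omega>\<in>I. interior_product X \<omega> \<in> I)}"

definition same_leaf :: "'a::euclidean_space set \<Rightarrow> 'a form set \<Rightarrow> 'a \<Rightarrow> 'a \<Rightarrow> bool" where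
  "same_leaf U I a b \<longleftrightarrow>
     (\<exists>g. g piecewise_C1_differentiable_on {0..1} \<and> g ` {0..1} \<subseteq> U \<and> g 0 = a \<and> g 1 = b \<and>
          (\<forall>t\<in>{0<..<1}. \<forall>v. (g has_vector_derivative v) (at t) \<longrightarrow> v \<in> cauchy_char U I (g t)))"

text \<open>The fibres of \<open>f\<close> on \<open>U\<close> are exactly the leaves, so that \<open>f\<close> identifies \<open>f ` U\<close> with the
  leaf space.\<close>

definition leaf_projection ::
    "'a::euclidean_space set \<Rightarrow> 'a form set \<Rightarrow> ('a \<Rightarrow> 'b) \<Rightarrow> bool" where
  "leaf_projection U I f \<longleftrightarrow> (\<forall>a\<in>U. \<forall>b\<in>U. f a = f b \<longleftrightarrow> same_leaf U I a b)"

definition reduced_system ::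
    "'a::euclidean_space set \<Rightarrow> 'a form set \<Rightarrow> ('a \<Rightarrow> 'b::euclidean_space) \<Rightarrow> 'b form set \<Rightarrow> bool" where
  "reduced_system U I f I' \<longleftrightarrow>
     pfaffian_system (f ` U) I' \<and> I = alg_ideal U (pullback U f ` I')"

section \<open>Derived systems and type\<close>

text \<open>A family of subspaces of the cotangent spaces is given by its fibres
  \<open>J :: 'a \<Rightarrow> ('a \<Rightarrow>\<^sub>L real) set\<close>.\<close>

definition pfaffian_bundle :: "'a::euclidean_space set \<Rightarrow> 'a form set \<Rightarrow> 'a \<Rightarrow> ('a \<Rightarrow>\<^sub>L real) set" where
  "pfaffian_bundle U I m = {\<theta> m | \<theta>. smooth_on U \<theta> \<and> one_form U \<theta> \<in> I}"

definition subbundle_near ::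
    "'a::euclidean_space set \<Rightarrow> ('a \<Rightarrow> ('a \<Rightarrow>\<^sub>L real) set) \<Rightarrow> 'a \<Rightarrow> bool" where
  "subbundle_near U J m \<longleftrightarrow>
     (\<exists>V r (b :: nat \<Rightarrow> 'a \<Rightarrow> 'a \<Rightarrow>\<^sub>L real). open V \<and> m \<in> V \<and> V \<subseteq> U \<and> (\<forall>i<r. smooth_on V (b i)) \<and>
        (\<forall>x\<in>V. inj_on (\<lambda>i. b i x) {..<r} \<and> independent ((\<lambda>i. b i x) ` {..<r}) \<and>
               J x = span ((\<lambda>i. b i x) ` {..<r})))"

text \<open>\<open>w\<close> lies in the kernel \<open>S \<and> T\<^sup>*\<close> of \<open>\<And>\<^sup>2 T\<^sup>* \<rightarrow> \<And>\<^sup>2 (T\<^sup>*/S)\<close>, i.e. \<open>w \<equiv> 0\<close> modulo \<open>S\<close>.\<close>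

definition zero_mod :: "('a::euclidean_space \<Rightarrow>\<^sub>L real) set \<Rightarrow> ('a list \<Rightarrow> real) \<Rightarrow> bool" where
  "zero_mod S w \<longleftrightarrow>
     (\<exists>n (e :: nat \<Rightarrow> 'a \<Rightarrow>\<^sub>L real) (\<phi> :: nat \<Rightarrow> 'a \<Rightarrow>\<^sub>L real). (\<forall>i<n. e i \<in> S) \<and>
        w = (\<lambda>vs. \<Sum>i<n. wedge (covector (e i)) (covector (\<phi> i)) vs))"

text \<open>The fibre at \<open>m\<close> of the kernel of \<open>\<delta>'\<close>, where \<open>\<delta>'\<close> sends \<open>\<theta> m\<close> to \<open>d\<theta> m mod J m\<close> for a
  local section \<open>\<theta>\<close> of \<open>J\<close>.\<close>

definition derived_system ::
    "'a::euclidean_space set \<Rightarrow> ('a \<Rightarrow> ('a \<Rightarrow>\<^sub>L real) set) \<Rightarrow> 'a \<Rightarrow> ('a \<Rightarrow>\<^sub>L real) set" where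
  "derived_system U J m =
     {\<theta> m | \<theta> V. open V \<and> m \<in> V \<and> V \<subseteq> U \<and> smooth_on V \<theta> \<and> (\<forall>x\<in>V. \<theta> x \<in> J x) \<and>
                 zero_mod (J m) (ext_d V (one_form V \<theta>) m)}"

definition derived_flag ::
    "'a::euclidean_space set \<Rightarrow> ('a \<Rightarrow> ('a \<Rightarrow>\<^sub>L real) set) \<Rightarrow> nat \<Rightarrow> 'a \<Rightarrow> ('a \<Rightarrow>\<^sub>L real) set" where
  "derived_flag U J k = (derived_system U ^^ k) J"

definition corank :: "('a::euclidean_space \<Rightarrow>\<^sub>L real) set \<Rightarrow> nat" where
  "corank S = DIM('a) - dim S"

text \<open>The system \<open>I\<close> is of type \<open>cs\<close> at \<open>m\<close>. The next derived system is formed only from a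
  subbundle, hence the condition that the members of the flag are subbundles near \<open>m\<close>.\<close>

definition has_type_at :: "'a::euclidean_space set \<Rightarrow> 'a form set \<Rightarrow> 'a \<Rightarrow> nat list \<Rightarrow> bool" where
  "has_type_at U I m cs \<longleftrightarrow>
     (let J = derived_flag U (pfaffian_bundle U I) in
      \<exists>N. (\<forall>k\<le>N. subbundle_near U (J k) m) \<and>
          J N m = J (Suc N) m \<and> (\<forall>k<N. J k m \<noteq> J (Suc k) m) \<and>
          cs = map (\<lambda>k. corank (J k m)) [0..<Suc N])"

section \<open>The system on the jet space\<close>

text \<open>The coordinates \<open>(x, y, z, p, q)\<close> of a point \<open>a\<close> are \<open>(a $ 1, \<dots>, a $ 5)\<close>.\<close>

definition pd :: "5 \<Rightarrow> (real^5 \<Rightarrow> real) \<Rightarrow> real^5 \<Rightarrow> real" where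
  "pd i f a = frechet_derivative f (at a) (axis i 1)"

definition dcoord :: "5 \<Rightarrow> (real^5) \<Rightarrow>\<^sub>L real" where
  "dcoord i = Blinfun (\<lambda>v. v $ i)"

definition involutive_type :: "(real^5) set \<Rightarrow> (real^5 \<Rightarrow> real) \<Rightarrow> bool" where
  "involutive_type D \<alpha> \<longleftrightarrow>
     (\<forall>a\<in>D. pd 1 \<alpha> a + a $ 4 * pd 3 \<alpha> a - \<alpha> a * (pd 2 \<alpha> a + a $ 5 * pd 3 \<alpha> a) = 0)"

definition non_generic_type :: "(real^5) set \<Rightarrow> (real^5 \<Rightarrow> real) \<Rightarrow> bool" where
  "non_generic_type D \<alpha> \<longleftrightarrow> (\<forall>a\<in>D. 1 + a $ 1 * (pd 2 \<alpha> a + a $ 5 * pd 3 \<alpha> a) = 0)"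

definition jet_system :: "(real^5) set \<Rightarrow> (real^5 \<Rightarrow> real) \<Rightarrow> (real^5) form set" where
  "jet_system D \<alpha> = diff_ideal D
     {one_form D (\<lambda>a. dcoord 3 - a $ 4 *\<^sub>R dcoord 1 - a $ 5 *\<^sub>R dcoord 2),
      one_form D (\<lambda>a. dcoord 4 - \<alpha> a *\<^sub>R dcoord 5)}"

definition leaf_coords :: "(real^5 \<Rightarrow> real) \<Rightarrow> real^5 \<Rightarrow> real^4" where
  "leaf_coords \<alpha> a = vector [\<alpha> a, a $ 3 - a $ 4 * a $ 1 - a $ 5 * a $ 2, a $ 4, a $ 5]"

end

theory Submission
  imports Defs
begin

text \<open>In degree one, \<open>\<I>\<close> being the ideal generated by \<open>\<pi>\<^sup>* \<I>'\<close> says that the fibre of \<open>\<I>\<close> at \<open>a\<close> is the pull-back of the fibre of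
  \<open>\<I>'\<close> at \<open>\<pi> a\<close>. Since \<open>\<pi>\<close> is a submersion and the two generators of \<open>\<I>\<close> are pull-backs of
  \<open>\<theta>\<^sub>1 + x \<theta>\<^sub>2\<close> and \<open>\<theta>\<^sub>2\<close>, where \<open>\<theta>\<^sub>1 = dx\<^sub>2 + \<beta> dx\<^sub>4\<close>, \<open>\<theta>\<^sub>2 = dx\<^sub>3 - x\<^sub>1 dx\<^sub>4\<close> and \<open>\<beta> = y + \<alpha> x\<close>,
  the fibre of \<open>\<I>'\<close> is spanned by \<open>\<theta>\<^sub>1\<close> and \<open>\<theta>\<^sub>2\<close>; in particular \<open>\<beta>\<close> descends to the leaf space,
  and to a smooth function because \<open>\<I>'\<close> has smooth generators.
  Differentiating \<open>\<beta>\<close> along lifts of the coordinate vectors gives \<open>\<partial>\<beta>/\<partial>x\<^sub>1 = 0\<close> and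
  \<open>\<partial>\<beta>/\<partial>x\<^sub>3 = x (\<alpha>\<^sub>p + x \<alpha>\<^sub>z)\<close>. Modulo \<open>\<theta>\<^sub>1, \<theta>\<^sub>2\<close> we have \<open>d\<theta>\<^sub>1 = 0\<close> and \<open>d\<theta>\<^sub>2 = - dx\<^sub>1 \<and> dx\<^sub>4\<close>, so the first
  derived system is spanned by \<open>\<theta>\<^sub>1\<close>, and \<open>d\<theta>\<^sub>1 = \<partial>\<beta>/\<partial>x\<^sub>3 dx\<^sub>3 \<and> dx\<^sub>4\<close> modulo \<open>\<theta>\<^sub>1\<close> decides the second.\<close>

section \<open>Smooth functions\<close>

lemma frechet_derivative_cong:
  assumes "open U" "x \<in> U" "\<And>y. y \<in> U \<Longrightarrow> f y = g y"
  shows "frechet_derivative f (at x) = frechet_derivative g (at x)"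
proof -
  have "(f has_derivative D) (at x) \<longleftrightarrow> (g has_derivative D) (at x)" for D
    using has_derivative_transform_within_open[OF _ assms(1,2), of f D UNIV g]
      has_derivative_transform_within_open[OF _ assms(1,2), of g D UNIV f] assms(3)
    by auto
  then show ?thesis
    by (simp add: frechet_derivative_def)
qed

lemma Ck_on_cong:
  assumes "open U" "\<And>y. y \<in> U \<Longrightarrow> f y = g y" "Ck_on k f U"
  shows "Ck_on k g U"
  using assms(2,3)
proof (induction k arbitrary: f g)
  case 0
  then show ?case
    by (simp cong: continuous_on_cong)
next
  case (Suc k)
  show ?case
    unfolding Ck_on.simps(2)
  proof (intro conjI ballI allI)
    show "g differentiable at x" if "x \<in> U" for x
    proof -
      have "(f has_derivative frechet_derivative f (at x)) (at x)"
        using Suc.prems(2) that by (simp flip: frechet_derivative_works)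
      then have "(g has_derivative frechet_derivative f (at x)) (at x)"
        by (rule has_derivative_transform_within_open[OF _ assms(1) that Suc.prems(1)])
      then show ?thesis
        unfolding differentiable_def by blast
    qed
    show "Ck_on k (\<lambda>x. frechet_derivative g (at x) v) U" for v
    proof (rule Suc.IH)
      show "frechet_derivative f (at x) v = frechet_derivative g (at x) v" if "x \<in> U" for x
        using frechet_derivative_cong[OF assms(1) that Suc.prems(1)] by simp
      show "Ck_on k (\<lambda>x. frechet_derivative f (at x) v) U"
        using Suc.prems(2) by simp
    qed
  qed
qed

lemma Ck_on_SucD: "Ck_on (Suc k) f U \<Longrightarrow> Ck_on k f U"
proof (induction k arbitrary: f)
  case 0
  then show ?case
    by (auto intro!: continuous_at_imp_continuous_on differentiable_imp_continuous_within)
next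
  case (Suc k)
  show ?case
    unfolding Ck_on.simps(2)[of k f]
  proof (intro conjI ballI allI)
    show "f differentiable at x" if "x \<in> U" for x
      using Suc.prems that by simp
    show "Ck_on k (\<lambda>x. frechet_derivative f (at x) v) U" for v
      using Suc.prems by (intro Suc.IH) (simp only: Ck_on.simps(2)[of "Suc k" f])
  qed
qed

lemma Ck_on_subset: "Ck_on k f U \<Longrightarrow> V \<subseteq> U \<Longrightarrow> Ck_on k f V"
proof (induction k arbitrary: f)
  case 0
  then show ?case
    using continuous_on_subset by auto
next
  case (Suc k)
  then show ?case
    by (simp add: subset_iff)
qed

text \<open>Continuity and differentiability are local, and the directional derivatives inherit the
  hypothesis. This serves functions that are given by a formula only near each point.\<close>

lemma Ck_on_local:
  assumes "\<And>x. x \<in> U \<Longrightarrow> \<exists>V. open V \<and> x \<in> V \<and> Ck_on k f V"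
  shows "Ck_on k f U"
  using assms
proof (induction k arbitrary: f)
  case 0
  have "isCont f x" if x: "x \<in> U" for x
  proof -
    obtain V where "open V" "x \<in> V" "continuous_on V f"
      using 0[OF x] by auto
    then show ?thesis
      by (simp add: continuous_on_eq_continuous_at)
  qed
  then show ?case
    by (simp add: continuous_at_imp_continuous_on)
next
  case (Suc k)
  show ?case
    unfolding Ck_on.simps(2)
  proof (intro conjI ballI allI)
    show "f differentiable at x" if "x \<in> U" for x
      using Suc.prems[OF that] by auto
    show "Ck_on k (\<lambda>x. frechet_derivative f (at x) v) U" for v
    proof (rule Suc.IH)
      show "\<exists>V. open V \<and> x \<in> V \<and> Ck_on k (\<lambda>x. frechet_derivative f (at x) v) V" if "x \<in> U" for x
        using Suc.prems[OF that] by auto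
    qed
  qed
qed

lemma Ck_on_const: "Ck_on k (\<lambda>_. c) U"
  by (induction k arbitrary: c) auto

text \<open>On an open set the derivative is unique, so an explicit formula for it may replace
  \<open>frechet_derivative\<close>. The inductions below all use this.\<close>

lemma Ck_on_SucI:
  assumes "open U" "\<And>x. x \<in> U \<Longrightarrow> (f has_derivative f' x) (at x)"
    and "\<And>v. Ck_on k (\<lambda>x. f' x v) U"
  shows "Ck_on (Suc k) f U"
proof -
  have "Ck_on k (\<lambda>x. frechet_derivative f (at x) v) U" for v
  proof (rule Ck_on_cong[OF assms(1) _ assms(3)])
    show "f' x v = frechet_derivative f (at x) v" if "x \<in> U" for x
      using frechet_derivative_at[OF assms(2)[OF that]] by simp
  qed
  then show ?thesis
    using assms(2) by (auto simp: differentiable_def)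
qed

lemma Ck_on_has_derivative:
  "Ck_on (Suc k) f U \<Longrightarrow> x \<in> U \<Longrightarrow> (f has_derivative frechet_derivative f (at x)) (at x)"
  by (simp flip: frechet_derivative_works)

lemma Ck_on_bounded_linear:
  assumes "bounded_linear L" "open U" "Ck_on k f U"
  shows "Ck_on k (\<lambda>x. L (f x)) U"
  using assms(3)
proof (induction k arbitrary: f)
  case 0
  then show ?case
    using assms by (simp add: bounded_linear.continuous_on)
next
  case (Suc k)
  show ?case
  proof (rule Ck_on_SucI[OF assms(2)])
    show "((\<lambda>x. L (f x)) has_derivative (\<lambda>v. L (frechet_derivative f (at x) v))) (at x)"
      if "x \<in> U" for x
      using assms(1) Ck_on_has_derivative[OF Suc.prems that] by (rule bounded_linear.has_derivative)
    show "Ck_on k (\<lambda>x. L (frechet_derivative f (at x) v)) U" for v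
      using Suc by simp
  qed
qed

lemma Ck_on_add:
  assumes "open U" "Ck_on k f U" "Ck_on k g U"
  shows "Ck_on k (\<lambda>x. f x + g x) U"
  using assms(2,3)
proof (induction k arbitrary: f g)
  case 0
  then show ?case
    by (simp add: continuous_on_add)
next
  case (Suc k)
  show ?case
  proof (rule Ck_on_SucI[OF assms(1)])
    show "((\<lambda>x. f x + g x) has_derivative
        (\<lambda>v. frechet_derivative f (at x) v + frechet_derivative g (at x) v)) (at x)"
      if "x \<in> U" for x
      by (intro has_derivative_add Ck_on_has_derivative[OF Suc.prems(1) that]
          Ck_on_has_derivative[OF Suc.prems(2) that])
    show "Ck_on k (\<lambda>x. frechet_derivative f (at x) v + frechet_derivative g (at x) v) U" for v
      using Suc by simp
  qed
qed

text \<open>The product rule gives two terms of the same bilinear shape. The undifferentiated factor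
  is one order smoother than needed and is lowered by \<open>Ck_on_SucD\<close>.\<close>

lemma Ck_on_bilinear:
  assumes "bounded_bilinear B" "open U" "Ck_on k f U" "Ck_on k g U"
  shows "Ck_on k (\<lambda>x. B (f x) (g x)) U"
  using assms(3,4)
proof (induction k arbitrary: f g)
  case 0
  then show ?case
    using assms by (simp add: bounded_bilinear.continuous_on)
next
  case (Suc k)
  show ?case
  proof (rule Ck_on_SucI[OF assms(2)])
    show "((\<lambda>x. B (f x) (g x)) has_derivative (\<lambda>v. B (f x) (frechet_derivative g (at x) v) +
        B (frechet_derivative f (at x) v) (g x))) (at x)" if "x \<in> U" for x
      by (intro bounded_bilinear.FDERIV[OF assms(1)] Ck_on_has_derivative[OF Suc.prems(1) that]
          Ck_on_has_derivative[OF Suc.prems(2) that])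
    show "Ck_on k (\<lambda>x. B (f x) (frechet_derivative g (at x) v) +
        B (frechet_derivative f (at x) v) (g x)) U" for v
      using Suc.prems Ck_on_SucD[of k f U] Ck_on_SucD[of k g U]
      by (intro Ck_on_add assms Suc.IH) simp_all
  qed
qed

text \<open>The derivative of the reciprocal is a product of reciprocals and the derivative of
  \<open>f\<close>, so the reciprocal at order \<open>k\<close> yields order
  \<open>Suc k\<close>.\<close>

lemma Ck_on_inverse:
  fixes f :: "'a::real_normed_vector \<Rightarrow> real"
  assumes "open U" "\<And>x. x \<in> U \<Longrightarrow> f x \<noteq> 0" "Ck_on k f U"
  shows "Ck_on k (\<lambda>x. inverse (f x)) U"
  using assms(3)
proof (induction k)
  case 0
  then show ?case
    using assms by (simp add: continuous_on_inverse)
next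
  case (Suc k)
  show ?case
  proof (rule Ck_on_SucI[OF assms(1)])
    show "((\<lambda>x. inverse (f x)) has_derivative
        (\<lambda>v. - (inverse (f x) * frechet_derivative f (at x) v * inverse (f x)))) (at x)"
      if "x \<in> U" for x
      by (intro Deriv.has_derivative_inverse assms(2) that Ck_on_has_derivative[OF Suc.prems])
    have "Ck_on k (\<lambda>x. inverse (f x)) U"
      using Suc Ck_on_SucD by blast
    then show "Ck_on k (\<lambda>x. - (inverse (f x) * frechet_derivative f (at x) v * inverse (f x))) U" for v
      using Suc.prems
      by (intro Ck_on_bounded_linear[OF bounded_linear_minus[OF bounded_linear_ident]]
          Ck_on_bilinear[OF bounded_bilinear_mult] assms(1)) simp_all
  qed
qed

section \<open>Closure properties of infinitely differentiable functions\<close>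

lemma smooth_on_cong:
  "open U \<Longrightarrow> (\<And>y. y \<in> U \<Longrightarrow> f y = g y) \<Longrightarrow> smooth_on U f \<Longrightarrow> smooth_on U g"
  by (simp add: smooth_on_def Ck_on_cong[of U f g])

lemma smooth_on_subset: "smooth_on U f \<Longrightarrow> V \<subseteq> U \<Longrightarrow> smooth_on V f"
  by (simp add: smooth_on_def Ck_on_subset[of _ f U V])

lemma smooth_on_local:
  assumes "\<And>x. x \<in> U \<Longrightarrow> \<exists>V. open V \<and> x \<in> V \<and> smooth_on V f"
  shows "smooth_on U f"
  unfolding smooth_on_def
proof (intro allI Ck_on_local)
  fix k x assume "x \<in> U"
  then show "\<exists>V. open V \<and> x \<in> V \<and> Ck_on k f V"
    using assms[of x] by (auto simp: smooth_on_def)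
qed

lemma smooth_on_const: "smooth_on U (\<lambda>_. c)"
  by (simp add: smooth_on_def Ck_on_const)

lemma smooth_on_bounded_linear:
  "bounded_linear L \<Longrightarrow> open U \<Longrightarrow> smooth_on U f \<Longrightarrow> smooth_on U (\<lambda>x. L (f x))"
  by (simp add: smooth_on_def Ck_on_bounded_linear)

lemma smooth_on_add:
  "open U \<Longrightarrow> smooth_on U f \<Longrightarrow> smooth_on U g \<Longrightarrow> smooth_on U (\<lambda>x. f x + g x)"
  by (simp add: smooth_on_def Ck_on_add)

lemma smooth_on_diff:
  "open U \<Longrightarrow> smooth_on U f \<Longrightarrow> smooth_on U g \<Longrightarrow> smooth_on U (\<lambda>x. f x - g x)"
  using smooth_on_add[of U f "\<lambda>x. - g x"]
    smooth_on_bounded_linear[OF bounded_linear_minus[OF bounded_linear_ident], of U g]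
  by simp

lemma smooth_on_mult:
  fixes f g :: "'a::real_normed_vector \<Rightarrow> real"
  shows "open U \<Longrightarrow> smooth_on U f \<Longrightarrow> smooth_on U g \<Longrightarrow> smooth_on U (\<lambda>x. f x * g x)"
  by (simp add: smooth_on_def Ck_on_bilinear[OF bounded_bilinear_mult])

lemma smooth_on_scaleR:
  "open U \<Longrightarrow> smooth_on U f \<Longrightarrow> smooth_on U g \<Longrightarrow> smooth_on U (\<lambda>x. f x *\<^sub>R g x)"
  by (simp add: smooth_on_def Ck_on_bilinear[OF bounded_bilinear_scaleR])

lemma smooth_on_divide:
  fixes f g :: "'a::real_normed_vector \<Rightarrow> real"
  assumes "open U" "smooth_on U f" "smooth_on U g" "\<And>x. x \<in> U \<Longrightarrow> g x \<noteq> 0"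
  shows "smooth_on U (\<lambda>x. f x / g x)"
  using smooth_on_mult[of U f "\<lambda>x. inverse (g x)"] assms
  by (simp add: smooth_on_def Ck_on_inverse divide_inverse)

lemma smooth_on_ident: "smooth_on U (\<lambda>x. x)"
  unfolding smooth_on_def
proof
  fix k show "Ck_on k (\<lambda>x. x) U"
    by (cases k) (auto simp: frechet_derivative_ident Ck_on_const)
qed

lemma smooth_on_nth: "open U \<Longrightarrow> smooth_on U (\<lambda>x::real^'n. x $ i)"
  by (rule smooth_on_bounded_linear[OF bounded_linear_vec_nth _ smooth_on_ident])

lemma smooth_on_apply: "open U \<Longrightarrow> smooth_on U \<theta> \<Longrightarrow> smooth_on U (\<lambda>x. blinfun_apply (\<theta> x) v)"
  by (rule smooth_on_bounded_linear[OF blinfun.bounded_linear_left])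

lemma smooth_on_has_derivative:
  "smooth_on U f \<Longrightarrow> x \<in> U \<Longrightarrow> (f has_derivative frechet_derivative f (at x)) (at x)"
  using Ck_on_has_derivative[of 0 f U x] by (simp add: smooth_on_def del: Ck_on.simps)

lemma smooth_on_imp_continuous_on: "smooth_on U f \<Longrightarrow> continuous_on U f"
  by (simp add: smooth_on_def flip: Ck_on.simps(1))

lemma smooth_on_frechet_derivative:
  assumes "smooth_on U f"
  shows "smooth_on U (\<lambda>x. frechet_derivative f (at x) v)"
  unfolding smooth_on_def
proof
  fix k
  have "Ck_on (Suc k) f U"
    using assms unfolding smooth_on_def by blast
  then show "Ck_on k (\<lambda>x. frechet_derivative f (at x) v) U"
    by simp
qed

section \<open>Exterior algebra in low degree\<close>

lemma wedge_zero_left [simp]: "wedge (\<lambda>_. 0) w' vs = 0"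
  by (induction vs arbitrary: w') auto

lemma wedge_zero_right [simp]: "wedge w (\<lambda>_. 0) vs = 0"
  by (induction vs arbitrary: w) auto

lemma wedge_scalar_left:
  "(\<And>v vs. w (v # vs) = 0) \<Longrightarrow> wedge w w' vs = w [] * w' vs"
proof (induction vs arbitrary: w w')
  case (Cons v vs)
  then show ?case
    using Cons.IH[of "\<lambda>us. (- 1) ^ length us * w us" "\<lambda>us. w' (v # us)"] by simp
qed simp

text \<open>Each step of the recursion feeds one argument to exactly one factor and lowers its
  degree by one. A factor of degree 0 vanishes when fed, which keeps the truncated subtractions
  harmless.\<close>

lemma wedge_degree:
  assumes "\<And>us. w us \<noteq> 0 \<Longrightarrow> length us = j" "\<And>us. w' us \<noteq> 0 \<Longrightarrow> length us = k"
    and "wedge w w' vs \<noteq> 0"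
  shows "length vs = j + k"
  using assms
proof (induction vs arbitrary: w w' j k)
  case Nil
  then have "w [] \<noteq> 0" "w' [] \<noteq> 0"
    by auto
  with Nil(1,2) show ?case
    by (metis add_0 list.size(3))
next
  case (Cons v vs)
  consider "wedge (\<lambda>us. w (v # us)) w' vs \<noteq> 0"
    | "wedge (\<lambda>us. (- 1) ^ length us * w us) (\<lambda>us. w' (v # us)) vs \<noteq> 0"
    using Cons.prems(3) by (metis add_0 wedge.simps(2))
  then show ?case
  proof cases
    case 1
    have "j \<noteq> 0"
    proof
      assume "j = 0"
      then have "w (v # us) = 0" for us
        using Cons.prems(1)[of "v # us"] by auto
      with 1 show False
        by simp
    qed
    have "length vs = (j - 1) + k"
    proof (rule Cons.IH[OF _ _ 1])
      show "length us = j - 1" if "w (v # us) \<noteq> 0" for us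
        using Cons.prems(1)[OF that] by simp
    qed (use Cons.prems(2) in auto)
    with \<open>j \<noteq> 0\<close> show ?thesis
      by simp
  next
    case 2
    have "k \<noteq> 0"
    proof
      assume "k = 0"
      then have "w' (v # us) = 0" for us
        using Cons.prems(2)[of "v # us"] by auto
      with 2 show False
        by simp
    qed
    have "length vs = j + (k - 1)"
    proof (rule Cons.IH[OF _ _ 2])
      show "length us = k - 1" if "w' (v # us) \<noteq> 0" for us
        using Cons.prems(2)[OF that] by simp
    qed (use Cons.prems(1) in auto)
    with \<open>k \<noteq> 0\<close> show ?thesis
      by simp
  qed
qed

lemma covector_simps [simp]:
  "covector e [] = 0" "covector e [v] = blinfun_apply e v" "covector e (u # v # vs) = 0"
  by (simp_all add: covector_def)

lemma length_if_covector: "covector e us \<noteq> 0 \<Longrightarrow> length us = 1"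
  by (cases us rule: remdups_adj.cases) auto

lemma wedge_covector2 [simp]:
  "wedge (covector e) (covector \<phi>) [u, v] =
    blinfun_apply e u * blinfun_apply \<phi> v - blinfun_apply e v * blinfun_apply \<phi> u"
  by simp

text \<open>An element concentrated in degree 2 is known from its values on pairs. This identifies
  an exterior derivative with a decomposable 2-form.\<close>

lemma wedge_covector_eqI:
  assumes "\<And>us. w us \<noteq> 0 \<Longrightarrow> length us = 2" "\<And>u v. w [u, v] =
    blinfun_apply e u * blinfun_apply \<phi> v - blinfun_apply e v * blinfun_apply \<phi> u"
  shows "w = wedge (covector e) (covector \<phi>)"
proof
  fix us
  show "w us = wedge (covector e) (covector \<phi>) us"
  proof (cases "length us = 2")
    case True
    then obtain u v where "us = [u, v]"
      by (auto simp: numeral_2_eq_2 length_Suc_conv)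
    then show ?thesis
      using assms(2) wedge_covector2 by metis
  next
    case False
    moreover have "wedge (covector e) (covector \<phi>) us = 0"
    proof (rule ccontr)
      assume nz: "wedge (covector e) (covector \<phi>) us \<noteq> 0"
      have "length us = 1 + 1"
        by (rule wedge_degree[OF _ _ nz]; erule length_if_covector)
      with False show False
        by simp
    qed
    ultimately show ?thesis
      using assms(1)[of us] by auto
  qed
qed

section \<open>Two-forms modulo a space of covectors, and exterior derivatives of 1-forms\<close>

lemma zero_mod_wedge: "e \<in> S \<Longrightarrow> zero_mod S (wedge (covector e) (covector \<phi>))"
  unfolding zero_mod_def
  by (intro exI[of _ 1] exI[of _ "\<lambda>_. e"] exI[of _ "\<lambda>_. \<phi>"]) auto

text \<open>Every summand has a factor from \<open>S\<close>, which kills both vectors. This bounds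
  derived systems from above.\<close>

lemma zero_mod_apply:
  assumes "zero_mod S w" "\<And>e. e \<in> S \<Longrightarrow> blinfun_apply e u = 0" "\<And>e. e \<in> S \<Longrightarrow> blinfun_apply e v = 0"
  shows "w [u, v] = 0"
  using assms unfolding zero_mod_def by fastforce

lemma ext_d_one_form:
  assumes "open V" "m \<in> V" "(\<theta> has_derivative \<theta>') (at m)"
  shows "ext_d V (one_form V \<theta>) m [u, v] = blinfun_apply (\<theta>' u) v - blinfun_apply (\<theta>' v) u"
    and "ext_d V (one_form V \<theta>) m us \<noteq> 0 \<Longrightarrow> length us = 2"
proof -
  have "frechet_derivative (\<lambda>y. one_form V \<theta> y [v]) (at m) = (\<lambda>u. blinfun_apply (\<theta>' u) v)" for v
  proof -
    have "((\<lambda>y. blinfun_apply (\<theta> y) v) has_derivative (\<lambda>u. blinfun_apply (\<theta>' u) v)) (at m)"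
      by (rule bounded_linear.has_derivative[OF blinfun.bounded_linear_left assms(3)])
    moreover have "frechet_derivative (\<lambda>y. one_form V \<theta> y [v]) (at m)
        = frechet_derivative (\<lambda>y. blinfun_apply (\<theta> y) v) (at m)"
      by (rule frechet_derivative_cong[OF assms(1,2)]) (simp add: one_form_def)
    ultimately show ?thesis
      using frechet_derivative_at by metis
  qed
  then show "ext_d V (one_form V \<theta>) m [u, v] = blinfun_apply (\<theta>' u) v - blinfun_apply (\<theta>' v) u"
    using assms(2) by (simp add: ext_d_def)
  show "length us = 2" if nz: "ext_d V (one_form V \<theta>) m us \<noteq> 0"
  proof (rule ccontr)
    assume "length us \<noteq> 2"
    \<comment> \<open>Deleting one entry of \<open>us\<close> does not leave a list of length 1, so
      each term differentiates the zero function.\<close>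
    have "one_form V \<theta> y (take i us @ drop (Suc i) us) = 0" if "i < length us" for i y
      using that \<open>length us \<noteq> 2\<close> length_if_covector[of "\<theta> y" "take i us @ drop (Suc i) us"]
      by (cases "covector (\<theta> y) (take i us @ drop (Suc i) us) = 0") (auto simp: one_form_def)
    then have "ext_d V (one_form V \<theta>) m us = 0"
      by (simp add: ext_d_def)
    with nz show False
      by simp
  qed
qed

text \<open>If \<open>\<theta>\<close> annihilates the constant field \<open>e\<close> and the field \<open>Y\<close>, then
  \<open>d\<theta>(e, Y) = - \<theta>([e, Y])\<close>, and \<open>[e, Y]\<close> is the derivative of \<open>Y\<close> along \<open>e\<close>.\<close>

lemma apply_bracket_eq_0:
  assumes "open V" "m \<in> V" "smooth_on V \<theta>"
    and "zero_mod S (ext_d V (one_form V \<theta>) m)"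
    and "\<And>x. x \<in> V \<Longrightarrow> blinfun_apply (\<theta> x) e = 0"
    and "\<And>x. x \<in> V \<Longrightarrow> blinfun_apply (\<theta> x) (Y x) = 0"
    and "(Y has_derivative Y') (at m)"
    and "\<And>\<sigma>. \<sigma> \<in> S \<Longrightarrow> blinfun_apply \<sigma> e = 0" "\<And>\<sigma>. \<sigma> \<in> S \<Longrightarrow> blinfun_apply \<sigma> (Y m) = 0"
  shows "blinfun_apply (\<theta> m) (Y' e) = 0"
proof -
  define \<theta>' where "\<theta>' = frechet_derivative \<theta> (at m)"
  have der: "(\<theta> has_derivative \<theta>') (at m)"
    using assms(2,3) by (simp add: \<theta>'_def smooth_on_has_derivative)
  have zero: "g' v = 0"
    if "(g has_derivative g') (at m)" "\<And>x. x \<in> V \<Longrightarrow> g x = 0" for g :: "'a \<Rightarrow> real" and g' v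
  proof -
    have "((\<lambda>_. 0) has_derivative g') (at m)"
      using has_derivative_transform_within_open[OF that(1) assms(1,2)] that(2) by simp
    then show ?thesis
      by (metis has_derivative_const has_derivative_unique)
  qed
  \<comment> \<open>The identity \<open>\<theta> x e = 0\<close> is differentiated along
    \<open>Y m\<close>, and next the identity \<open>\<theta> x (Y x) = 0\<close> along
    \<open>e\<close>.\<close>
  have 1: "blinfun_apply (\<theta>' (Y m)) e = 0"
    using zero[OF bounded_linear.has_derivative[OF blinfun.bounded_linear_left der]] assms(5)
    by blast
  have 2: "blinfun_apply (\<theta> m) (Y' e) + blinfun_apply (\<theta>' e) (Y m) = 0"
    using zero[OF bounded_bilinear.FDERIV[OF bounded_bilinear_blinfun_apply der assms(7)]] assms(6)
    by blast
  have "blinfun_apply (\<theta>' e) (Y m) - blinfun_apply (\<theta>' (Y m)) e = 0"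
    using zero_mod_apply[OF assms(4,8,9)] ext_d_one_form(1)[OF assms(1,2) der] by metis
  with 1 2 show ?thesis
    by simp
qed

section \<open>The 1-forms of a Pfaffian system\<close>

lemma covector_add: "covector (e + f) vs = covector e vs + covector f vs"
  by (cases vs rule: remdups_adj.cases) (auto simp: blinfun.add_left)

lemma covector_scaleR: "covector (c *\<^sub>R e) vs = c * covector e vs"
  by (cases vs rule: remdups_adj.cases) (auto simp: blinfun.scaleR_left)

lemma covector_zero: "covector 0 vs = 0"
  by (cases vs rule: remdups_adj.cases) auto

text \<open>Elements of the ideal have no part of degree 0. Hence in degree 1 a product with a form
  sees only the degree-0 part of that form, a scalar at \<open>x\<close>, and the values stay in the
  subspace \<open>S\<close>.\<close>

lemma alg_ideal_low_degree:
  assumes "\<eta> \<in> alg_ideal U G" "subspace S"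
    and "\<And>\<omega>. \<omega> \<in> G \<Longrightarrow> \<omega> x [] = 0 \<and> (\<exists>e\<in>S. \<forall>v. \<omega> x [v] = blinfun_apply e v)"
  shows "\<eta> x [] = 0 \<and> (\<exists>e\<in>S. \<forall>v. \<eta> x [v] = blinfun_apply e v)"
  using assms(1)
proof induction
  case zero
  then show ?case
    using assms(2) by (auto intro!: bexI[of _ 0] simp: subspace_def)
next
  case (gen \<omega>)
  then show ?case
    using assms(3) by simp
next
  case (add \<omega> \<eta>)
  then obtain e f where "e \<in> S" "f \<in> S" "\<And>v. \<omega> x [v] = blinfun_apply e v" "\<And>v. \<eta> x [v] = blinfun_apply f v"
    by blast
  with add assms(2) show ?case
    by (auto intro!: bexI[of _ "e + f"] simp: subspace_def blinfun.add_left)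
next
  case (mult_left \<omega> \<eta>)
  then obtain e where "e \<in> S" "\<And>v. \<eta> x [v] = blinfun_apply e v"
    by blast
  with mult_left assms(2) show ?case
    by (auto intro!: bexI[of _ "\<omega> x [] *\<^sub>R e"] simp: subspace_def blinfun.scaleR_left form_wedge_def)
next
  case (mult_right \<omega> \<eta>)
  then obtain e where "e \<in> S" "\<And>v. \<eta> x [v] = blinfun_apply e v"
    by blast
  with mult_right assms(2) show ?case
    by (auto intro!: bexI[of _ "\<omega> x [] *\<^sub>R e"] simp: subspace_def blinfun.scaleR_left form_wedge_def)
qed

lemma diff_ideal_low_degree:
  assumes "\<eta> \<in> diff_ideal U (one_form U ` T)" "x \<in> U"
  shows "\<eta> x [] = 0 \<and> (\<exists>e\<in>span ((\<lambda>\<theta>. \<theta> x) ` T). \<forall>v. \<eta> x [v] = blinfun_apply e v)"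
proof (rule alg_ideal_low_degree[OF assms(1)[unfolded diff_ideal_def]])
  let ?S = "span ((\<lambda>\<theta>. \<theta> x) ` T)"
  fix \<omega> assume "\<omega> \<in> one_form U ` T \<union> ext_d U ` one_form U ` T"
  then obtain \<theta> where "\<theta> \<in> T" and "\<omega> = one_form U \<theta> \<or> \<omega> = ext_d U (one_form U \<theta>)"
    by blast
  then show "\<omega> x [] = 0 \<and> (\<exists>e\<in>?S. \<forall>v. \<omega> x [v] = blinfun_apply e v)"
  proof (elim disjE)
    assume "\<omega> = one_form U \<theta>"
    then show ?thesis
      using \<open>\<theta> \<in> T\<close> assms(2) by (auto simp: one_form_def intro!: bexI[of _ "\<theta> x"] span_base)
  next
    \<comment> \<open>In degree 1, \<open>ext_d\<close> differentiates the degree-0 part of the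
      1-form, which is zero; the covector is therefore 0.\<close>
    assume "\<omega> = ext_d U (one_form U \<theta>)"
    moreover have "(\<lambda>y. one_form U \<theta> y []) = (\<lambda>_. 0)"
      by (simp add: one_form_def fun_eq_iff)
    ultimately show ?thesis
      by (auto simp: ext_d_def intro!: bexI[of _ 0] span_zero)
  qed
qed simp

text \<open>Makes multiplication by a constant a wedge product, hence an operation under which
  ideals are closed.\<close>

lemma constant_in_forms:
  assumes "open U"
  shows "(\<lambda>x vs. if x \<in> U \<and> vs = [] then c else 0) \<in> forms U"
proof -
  have "smooth_on U (\<lambda>x. if x \<in> U \<and> vs = [] then c else 0)" for vs :: "'a list"
    by (rule smooth_on_cong[OF assms _ smooth_on_const[of U "if vs = [] then c else 0"]]) auto
  then show ?thesis
    by (auto simp: forms_def alternating_def linear_iff)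
qed

lemma subspace_pfaffian_bundle:
  assumes "open U"
  shows "subspace (pfaffian_bundle U (diff_ideal U G) x)"
  unfolding subspace_def
proof (intro conjI ballI allI)
  let ?I = "diff_ideal U G"
  have "one_form U (\<lambda>_. 0) = (\<lambda>_ _. 0)"
    by (simp add: one_form_def covector_zero fun_eq_iff)
  then have "one_form U (\<lambda>_. 0) \<in> ?I"
    by (simp add: diff_ideal_def alg_ideal.zero)
  then show "0 \<in> pfaffian_bundle U ?I x"
    unfolding pfaffian_bundle_def by (intro CollectI exI[of _ "\<lambda>_. 0"]) (simp add: smooth_on_const)
next
  let ?I = "diff_ideal U G"
  fix e f assume "e \<in> pfaffian_bundle U ?I x" "f \<in> pfaffian_bundle U ?I x"
  then obtain \<theta> \<sigma> where ef: "e = \<theta> x" "f = \<sigma> x" and sm: "smooth_on U \<theta>" "smooth_on U \<sigma>"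
    and I: "one_form U \<theta> \<in> ?I" "one_form U \<sigma> \<in> ?I"
    unfolding pfaffian_bundle_def by blast
  have "one_form U (\<lambda>x. \<theta> x + \<sigma> x) = (\<lambda>x vs. one_form U \<theta> x vs + one_form U \<sigma> x vs)"
    by (simp add: one_form_def covector_add fun_eq_iff)
  then have "one_form U (\<lambda>x. \<theta> x + \<sigma> x) \<in> ?I"
    using I by (simp add: diff_ideal_def alg_ideal.add)
  then show "e + f \<in> pfaffian_bundle U ?I x"
    unfolding pfaffian_bundle_def ef using smooth_on_add[OF assms sm]
    by (intro CollectI exI[of _ "\<lambda>x. \<theta> x + \<sigma> x"]) simp
next
  let ?I = "diff_ideal U G"
  fix c e assume "e \<in> pfaffian_bundle U ?I x"
  then obtain \<theta> where e: "e = \<theta> x" and sm: "smooth_on U \<theta>" and I: "one_form U \<theta> \<in> ?I"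
    unfolding pfaffian_bundle_def by blast
  have "one_form U (\<lambda>x. c *\<^sub>R \<theta> x) =
      form_wedge (\<lambda>x vs. if x \<in> U \<and> vs = [] then c else 0) (one_form U \<theta>)"
    by (auto simp: one_form_def covector_scaleR fun_eq_iff form_wedge_def wedge_scalar_left)
  also have "\<dots> \<in> ?I"
    using I constant_in_forms[OF assms] unfolding diff_ideal_def by (rule alg_ideal.mult_left[rotated])
  finally show "c *\<^sub>R e \<in> pfaffian_bundle U ?I x"
    unfolding pfaffian_bundle_def e
    using smooth_on_scaleR[OF assms smooth_on_const sm]
    by (intro CollectI exI[of _ "\<lambda>x. c *\<^sub>R \<theta> x"]) simp
qed

text \<open>The degree-1 part of the ideal is pointwise spanned by the generators. Conversely each
  generator is itself a smooth section, and the fibre is a subspace.\<close>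

lemma pfaffian_bundle_diff_ideal:
  assumes "open U" "\<And>\<theta>. \<theta> \<in> T \<Longrightarrow> smooth_on U \<theta>" "x \<in> U"
  shows "pfaffian_bundle U (diff_ideal U (one_form U ` T)) x = span ((\<lambda>\<theta>. \<theta> x) ` T)"
proof
  show "pfaffian_bundle U (diff_ideal U (one_form U ` T)) x \<subseteq> span ((\<lambda>\<theta>. \<theta> x) ` T)"
  proof
    fix \<sigma> assume "\<sigma> \<in> pfaffian_bundle U (diff_ideal U (one_form U ` T)) x"
    then obtain \<theta> where \<theta>: "\<sigma> = \<theta> x" "one_form U \<theta> \<in> diff_ideal U (one_form U ` T)"
      unfolding pfaffian_bundle_def by blast
    then obtain e where e: "e \<in> span ((\<lambda>\<theta>. \<theta> x) ` T)" "\<And>v. one_form U \<theta> x [v] = blinfun_apply e v"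
      using diff_ideal_low_degree assms(3) by metis
    have "\<sigma> = e"
      using e(2) assms(3) \<theta>(1) by (intro blinfun_eqI) (simp add: one_form_def)
    with e show "\<sigma> \<in> span ((\<lambda>\<theta>. \<theta> x) ` T)"
      by simp
  qed
  show "span ((\<lambda>\<theta>. \<theta> x) ` T) \<subseteq> pfaffian_bundle U (diff_ideal U (one_form U ` T)) x"
  proof (rule span_minimal[OF _ subspace_pfaffian_bundle[OF assms(1)]])
    show "(\<lambda>\<theta>. \<theta> x) ` T \<subseteq> pfaffian_bundle U (diff_ideal U (one_form U ` T)) x"
      using assms(2) by (auto simp: pfaffian_bundle_def diff_ideal_def intro!: alg_ideal.gen)
  qed
qed

section \<open>Derived systems of the reduced system\<close>

lemma in_span_insert2: "\<sigma> \<in> span {e, f} \<longleftrightarrow> (\<exists>c d. \<sigma> = c *\<^sub>R e + d *\<^sub>R f)"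
proof -
  have "\<sigma> \<in> span {e, f} \<longleftrightarrow> (\<exists>c d. \<sigma> - c *\<^sub>R e = d *\<^sub>R f)"
    by (auto simp: span_breakdown_eq[of \<sigma> e] span_singleton)
  also have "\<dots> \<longleftrightarrow> (\<exists>c d. \<sigma> = c *\<^sub>R e + d *\<^sub>R f)"
    by (simp add: diff_eq_eq add.commute)
  finally show ?thesis .
qed

lemma derived_system_subset: "derived_system U J m \<subseteq> J m"
  unfolding derived_system_def by blast

lemma zero_in_derived_system:
  assumes "open U" "m \<in> U" "\<And>x. x \<in> U \<Longrightarrow> 0 \<in> J x"
  shows "0 \<in> derived_system U J m"
proof -
  have "(\<lambda>y. one_form U (\<lambda>_. 0) y vs) = (\<lambda>_. 0)" for vs :: "'a list"
    by (simp add: one_form_def covector_zero fun_eq_iff)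
  then have "ext_d U (one_form U (\<lambda>_. 0)) m = (\<lambda>_. 0)"
    by (simp add: ext_d_def fun_eq_iff)
  then have "zero_mod (J m) (ext_d U (one_form U (\<lambda>_. 0)) m)"
    unfolding zero_mod_def by (intro exI[of _ 0]) simp
  then show ?thesis
    unfolding derived_system_def mem_Collect_eq
    using assms by (intro exI[of _ "\<lambda>_. 0"] exI[of _ U]) (auto simp: smooth_on_const)
qed

definition dx :: "'n::finite \<Rightarrow> (real^'n) \<Rightarrow>\<^sub>L real" where
  "dx i = Blinfun (\<lambda>v. v $ i)"

lemma dx_apply [simp]: "blinfun_apply (dx i) v = v $ i"
  by (simp add: dx_def bounded_linear_Blinfun_apply bounded_linear_vec_nth)

text \<open>The data on which the type depends: the system enters only through its fibres of
  1-forms, and \<open>b\<close> is independent of the first coordinate.\<close>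

locale reduced_pfaffian =
  fixes U :: "(real^4) set" and I :: "(real^4) form set" and b :: "real^4 \<Rightarrow> real"
  assumes open_U: "open U" and smooth_b: "smooth_on U b"
    and b_deriv1: "\<And>x. x \<in> U \<Longrightarrow> frechet_derivative b (at x) (axis 1 1) = 0"
    and fibre: "\<And>x. x \<in> U \<Longrightarrow>
      pfaffian_bundle U I x = span {dx 2 + b x *\<^sub>R dx 4, dx 3 - x $ 1 *\<^sub>R dx 4}"
begin

definition \<theta>1 :: "real^4 \<Rightarrow> (real^4) \<Rightarrow>\<^sub>L real" where "\<theta>1 x = dx 2 + b x *\<^sub>R dx 4"
definition \<theta>2 :: "real^4 \<Rightarrow> (real^4) \<Rightarrow>\<^sub>L real" where "\<theta>2 x = dx 3 - x $ 1 *\<^sub>R dx 4"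
definition b3 :: "real^4 \<Rightarrow> real" where "b3 x = frechet_derivative b (at x) (axis 3 1)"

lemma \<theta>1_apply: "blinfun_apply (\<theta>1 x) v = v $ 2 + b x * v $ 4"
  by (simp add: \<theta>1_def blinfun.add_left blinfun.scaleR_left)

lemma \<theta>2_apply: "blinfun_apply (\<theta>2 x) v = v $ 3 - x $ 1 * v $ 4"
  by (simp add: \<theta>2_def blinfun.diff_left blinfun.scaleR_left)

lemma smooth_\<theta>1: "smooth_on U \<theta>1"
  unfolding \<theta>1_def by (intro smooth_on_add smooth_on_scaleR smooth_on_const smooth_b open_U)

lemma smooth_\<theta>2: "smooth_on U \<theta>2"
  unfolding \<theta>2_def by (intro smooth_on_diff smooth_on_scaleR smooth_on_const smooth_on_nth open_U)

lemma b_has_derivative: "x \<in> U \<Longrightarrow> (b has_derivative frechet_derivative b (at x)) (at x)"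
  by (rule smooth_on_has_derivative[OF smooth_b])

lemma b_deriv_apply:
  assumes "x \<in> U"
  shows "frechet_derivative b (at x) v =
    frechet_derivative b (at x) (axis 2 1) * v $ 2 + b3 x * v $ 3 +
    frechet_derivative b (at x) (axis 4 1) * v $ 4"
proof -
  interpret bounded_linear "frechet_derivative b (at x)"
    using b_has_derivative[OF assms] by (rule has_derivative_bounded_linear)
  have "v = v $ 1 *\<^sub>R axis 1 1 + v $ 2 *\<^sub>R axis 2 1 + v $ 3 *\<^sub>R axis 3 1 + v $ 4 *\<^sub>R axis 4 1"
    by (simp add: vec_eq_iff forall_4 axis_def)
  then have "frechet_derivative b (at x) v = frechet_derivative b (at x)
      (v $ 1 *\<^sub>R axis 1 1 + v $ 2 *\<^sub>R axis 2 1 + v $ 3 *\<^sub>R axis 3 1 + v $ 4 *\<^sub>R axis 4 1)"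
    by simp
  then show ?thesis
    using b_deriv1[OF assms] by (simp add: add scaleR b3_def mult.commute)
qed

text \<open>On the second and third coordinate vectors the two forms are dual.\<close>

lemma \<theta>_independent: "\<theta>1 x \<notin> span {\<theta>2 x}" "\<theta>2 x \<notin> span {\<theta>1 x}" "\<theta>1 x \<noteq> 0" "\<theta>2 x \<noteq> 0" "\<theta>1 x \<noteq> \<theta>2 x"
proof -
  have 1: "blinfun_apply (\<theta>1 x) (axis 2 1) = 1" "blinfun_apply (\<theta>1 x) (axis 3 1) = 0"
    "blinfun_apply (\<theta>2 x) (axis 2 1) = 0" "blinfun_apply (\<theta>2 x) (axis 3 1) = 1"
    by (simp_all add: \<theta>1_apply \<theta>2_apply axis_def)
  show "\<theta>1 x \<notin> span {\<theta>2 x}"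
  proof
    assume "\<theta>1 x \<in> span {\<theta>2 x}"
    then obtain c where "\<theta>1 x = c *\<^sub>R \<theta>2 x"
      by (auto simp: span_singleton)
    with 1 show False
      by (simp add: blinfun.scaleR_left)
  qed
  show "\<theta>2 x \<notin> span {\<theta>1 x}"
  proof
    assume "\<theta>2 x \<in> span {\<theta>1 x}"
    then obtain c where "\<theta>2 x = c *\<^sub>R \<theta>1 x"
      by (auto simp: span_singleton)
    with 1 show False
      by (simp add: blinfun.scaleR_left)
  qed
  show "\<theta>1 x \<noteq> 0" "\<theta>2 x \<noteq> 0" "\<theta>1 x \<noteq> \<theta>2 x"
    using 1 by auto
qed

text \<open>The exterior derivative of \<open>\<theta>1\<close> is \<open>db\<close> wedge
  \<open>dx 4\<close>. Modulo \<open>dx 4\<close>, \<open>dx 2\<close> and \<open>dx 3\<close> are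
  \<open>\<theta>1\<close> and \<open>\<theta>2\<close>, so only the term
  \<open>b3 m *\<^sub>R \<theta>2 m\<close> must be assumed to lie in \<open>J m\<close>. The lemma
  serves the first derived system, and the second where \<open>b3\<close> vanishes.\<close>

lemma span_\<theta>1_subset_derived:
  assumes "m \<in> U" "\<And>x. x \<in> U \<Longrightarrow> span {\<theta>1 x} \<subseteq> J x" "subspace (J m)" "b3 m *\<^sub>R \<theta>2 m \<in> J m"
  shows "span {\<theta>1 m} \<subseteq> derived_system U J m"
proof
  fix \<sigma> assume "\<sigma> \<in> span {\<theta>1 m}"
  then obtain c where c: "\<sigma> = c *\<^sub>R \<theta>1 m"
    by (auto simp: span_singleton)
  define \<theta> where "\<theta> x = c *\<^sub>R \<theta>1 x" for x
  \<comment> \<open>The left factor of the derivative of \<open>\<theta>\<close>: \<open>c\<close>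
    times \<open>db\<close>, rewritten modulo \<open>dx 4\<close> with \<open>\<theta>1\<close> and
    \<open>\<theta>2\<close>.\<close>
  define e where "e = c *\<^sub>R (frechet_derivative b (at m) (axis 2 1) *\<^sub>R \<theta>1 m + b3 m *\<^sub>R \<theta>2 m)"
  have sm: "smooth_on U \<theta>"
    unfolding \<theta>_def by (intro smooth_on_scaleR smooth_on_const open_U smooth_\<theta>1)
  have der: "(\<theta> has_derivative (\<lambda>h. c *\<^sub>R (frechet_derivative b (at m) h *\<^sub>R dx 4))) (at m)"
    unfolding \<theta>_def \<theta>1_def by (auto intro!: derivative_eq_intros b_has_derivative[OF assms(1)])
  have "ext_d U (one_form U \<theta>) m = wedge (covector e) (covector (dx 4))"
  proof (rule wedge_covector_eqI)
    show "length us = 2" if "ext_d U (one_form U \<theta>) m us \<noteq> 0" for us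
      using ext_d_one_form(2)[OF open_U assms(1) der that] .
    show "ext_d U (one_form U \<theta>) m [u, v] =
        blinfun_apply e u * blinfun_apply (dx 4) v - blinfun_apply e v * blinfun_apply (dx 4) u" for u v
      unfolding ext_d_one_form(1)[OF open_U assms(1) der] b_deriv_apply[OF assms(1), of u]
        b_deriv_apply[OF assms(1), of v]
      by (simp add: e_def blinfun.add_left blinfun.scaleR_left \<theta>1_apply \<theta>2_apply algebra_simps)
  qed
  moreover have "\<theta>1 m \<in> J m"
    using assms(2)[OF assms(1)] by (auto intro: span_base)
  then have "e \<in> J m"
    unfolding e_def by (simp add: subspace_scale subspace_add assms(3,4))
  ultimately have "zero_mod (J m) (ext_d U (one_form U \<theta>) m)"
    using zero_mod_wedge by metis
  moreover have "\<theta> x \<in> J x" if "x \<in> U" for x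
    using assms(2)[OF that] by (auto simp: \<theta>_def span_singleton)
  moreover have "\<sigma> = \<theta> m"
    by (simp add: c \<theta>_def)
  ultimately show "\<sigma> \<in> derived_system U J m"
    unfolding derived_system_def using sm open_U assms(1) by blast
qed

lemma bundle_\<theta>: "x \<in> U \<Longrightarrow> pfaffian_bundle U I x = span {\<theta>1 x, \<theta>2 x}"
  by (simp add: fibre \<theta>1_def \<theta>2_def)

text \<open>The fields \<open>axis 1 1\<close> and \<open>Y\<close> are annihilated by the system,
  and their bracket is \<open>axis 3 1\<close> because \<open>b\<close> does not vary along the
  first coordinate. A section in the kernel annihilates it, so its \<open>\<theta>2\<close>
  coefficient vanishes at \<open>m\<close>.\<close>

lemma derived1:
  assumes m: "m \<in> U"
  shows "derived_system U (pfaffian_bundle U I) m = span {\<theta>1 m}"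
proof
  show "derived_system U (pfaffian_bundle U I) m \<subseteq> span {\<theta>1 m}"
  proof
    fix \<sigma> assume "\<sigma> \<in> derived_system U (pfaffian_bundle U I) m"
    then obtain \<theta> V where \<sigma>: "\<sigma> = \<theta> m" and V: "open V" "m \<in> V" "V \<subseteq> U" "smooth_on V \<theta>"
      and \<theta>: "\<And>x. x \<in> V \<Longrightarrow> \<theta> x \<in> pfaffian_bundle U I x"
      and zm: "zero_mod (pfaffian_bundle U I m) (ext_d V (one_form V \<theta>) m)"
      unfolding derived_system_def by blast
    define Y :: "real^4 \<Rightarrow> real^4"
      where "Y x = axis 4 1 + x $ 1 *\<^sub>R axis 3 1 - b x *\<^sub>R axis 2 1" for x
    have ann: "blinfun_apply \<sigma> (axis 1 1) = 0" "blinfun_apply \<sigma> (Y x) = 0"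
      if "\<sigma> \<in> pfaffian_bundle U I x" "x \<in> U" for \<sigma> x
      using that by (auto simp: bundle_\<theta> in_span_insert2 \<theta>1_apply \<theta>2_apply blinfun.add_left
          blinfun.scaleR_left Y_def axis_def)
    have zero: "blinfun_apply (\<theta> x) (axis 1 1) = 0" "blinfun_apply (\<theta> x) (Y x) = 0" if "x \<in> V" for x
      using ann[OF \<theta>[OF that]] that V(3) by auto
    let ?Y' = "\<lambda>h. h $ 1 *\<^sub>R axis 3 1 - frechet_derivative b (at m) h *\<^sub>R axis 2 1"
    have "blinfun_apply (\<theta> m) (?Y' (axis 1 1)) = 0"
    proof (rule apply_bracket_eq_0[OF V(1,2,4) zm, where Y = Y and Y' = ?Y'])
      show "(Y has_derivative ?Y') (at m)"
        unfolding Y_def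
        by (auto intro!: derivative_eq_intros b_has_derivative[OF m] bounded_linear_imp_has_derivative
            bounded_linear_vec_nth)
    qed (use ann[OF _ m] zero in auto)
    then have "blinfun_apply (\<theta> m) (axis 3 1) = 0"
      by (simp add: b_deriv1[OF m])
    moreover obtain c d where "\<theta> m = c *\<^sub>R \<theta>1 m + d *\<^sub>R \<theta>2 m"
      using \<theta>[OF V(2)] m by (auto simp: bundle_\<theta> in_span_insert2)
    ultimately show "\<sigma> \<in> span {\<theta>1 m}"
      by (auto simp: \<sigma> blinfun.add_left blinfun.scaleR_left \<theta>1_apply \<theta>2_apply axis_def span_singleton)
  qed
  show "span {\<theta>1 m} \<subseteq> derived_system U (pfaffian_bundle U I) m"
  proof (rule span_\<theta>1_subset_derived[OF m])
    show "span {\<theta>1 x} \<subseteq> pfaffian_bundle U I x" if "x \<in> U" for x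
      using that by (auto simp: bundle_\<theta> intro!: span_mono)
    show "b3 m *\<^sub>R \<theta>2 m \<in> pfaffian_bundle U I m"
      by (simp add: bundle_\<theta> m span_scale span_base)
  qed (simp add: bundle_\<theta> m)
qed

text \<open>Now \<open>axis 3 1\<close> and \<open>Y\<close> are annihilated by
  \<open>\<theta>1\<close>, with bracket \<open>- b3 m *\<^sub>R axis 2 1\<close> at
  \<open>m\<close>. If \<open>b3 m\<close> is nonzero, the multiple of \<open>\<theta>1 m\<close>
  must be zero. The case distinction concerns the point \<open>m\<close> alone.\<close>

lemma derived2:
  assumes m: "m \<in> U" and J: "\<And>x. x \<in> U \<Longrightarrow> J x = span {\<theta>1 x}"
  shows "derived_system U J m = (if b3 m = 0 then span {\<theta>1 m} else {0})"
proof (cases "b3 m = 0")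
  case True
  then have "span {\<theta>1 m} \<subseteq> derived_system U J m"
    by (intro span_\<theta>1_subset_derived[OF m]) (auto simp: J m span_zero)
  then show ?thesis
    using True derived_system_subset[of U J m] J[OF m] by auto
next
  case False
  have "\<sigma> = 0" if d: "\<sigma> \<in> derived_system U J m" for \<sigma>
  proof -
    obtain \<theta> V where \<sigma>: "\<sigma> = \<theta> m" and V: "open V" "m \<in> V" "V \<subseteq> U" "smooth_on V \<theta>"
      and \<theta>: "\<And>x. x \<in> V \<Longrightarrow> \<theta> x \<in> J x" and zm: "zero_mod (J m) (ext_d V (one_form V \<theta>) m)"
      using d unfolding derived_system_def by blast
    define Y :: "real^4 \<Rightarrow> real^4" where "Y x = axis 4 1 - b x *\<^sub>R axis 2 1" for x
    have ann: "blinfun_apply \<sigma> (axis 3 1) = 0" "blinfun_apply \<sigma> (Y x) = 0"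
      if "\<sigma> \<in> J x" "x \<in> U" for \<sigma> x
      using that by (auto simp: J span_singleton \<theta>1_apply blinfun.scaleR_left Y_def axis_def)
    have zero: "blinfun_apply (\<theta> x) (axis 3 1) = 0" "blinfun_apply (\<theta> x) (Y x) = 0" if "x \<in> V" for x
      using ann[OF \<theta>[OF that]] that V(3) by auto
    let ?Y' = "\<lambda>h. - frechet_derivative b (at m) h *\<^sub>R axis 2 1"
    have "blinfun_apply (\<theta> m) (?Y' (axis 3 1)) = 0"
    proof (rule apply_bracket_eq_0[OF V(1,2,4) zm, where Y = Y and Y' = ?Y'])
      show "(Y has_derivative ?Y') (at m)"
        unfolding Y_def by (auto intro!: derivative_eq_intros b_has_derivative[OF m])
    qed (use ann[OF _ m] zero in auto)
    then have "blinfun_apply (\<theta> m) (axis 2 1) = 0"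
      using False by (simp add: b3_def blinfun.scaleR_right blinfun.minus_right)
    moreover obtain c where "\<theta> m = c *\<^sub>R \<theta>1 m"
      using \<theta>[OF V(2)] m by (auto simp: J span_singleton)
    ultimately show ?thesis
      by (simp add: \<sigma> blinfun.scaleR_left \<theta>1_apply axis_def)
  qed
  moreover have "0 \<in> derived_system U J m"
    by (rule zero_in_derived_system[OF open_U m]) (simp add: J span_zero)
  ultimately show ?thesis
    using False by auto
qed

text \<open>The flag is stationary from step 1 at \<open>m\<close> exactly when
  \<open>b3 m = 0\<close>; otherwise it drops to zero at step 2 and stays there.\<close>

lemma type_iff:
  assumes m: "m \<in> U"
  shows "has_type_at U I m [2, 3] \<longleftrightarrow> b3 m = 0" "has_type_at U I m [2, 3, 4] \<longleftrightarrow> b3 m \<noteq> 0"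
proof -
  define J where "J = derived_flag U (pfaffian_bundle U I)"
  have J_Suc: "J (Suc k) = derived_system U (J k)" for k
    by (simp add: J_def derived_flag_def)
  have J0: "J 0 x = span {\<theta>1 x, \<theta>2 x}" if "x \<in> U" for x
    using that by (simp add: J_def derived_flag_def bundle_\<theta>)
  have J1: "J 1 x = span {\<theta>1 x}" if "x \<in> U" for x
    using that derived1 by (simp add: J_def derived_flag_def)
  have J2: "J 2 x = (if b3 x = 0 then span {\<theta>1 x} else {0})" if "x \<in> U" for x
    using derived2[OF that J1] J_Suc[of 1] by (simp add: numeral_2_eq_2)
  have J3: "J 3 m = J 2 m" if "b3 m \<noteq> 0"
  proof -
    have "0 \<in> J 3 m"
      using zero_in_derived_system[OF open_U m, of "J 2"] J2 J_Suc[of 2]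
      by (simp add: span_zero numeral_eq_Suc)
    moreover have "J 3 m \<subseteq> J 2 m"
      using derived_system_subset[of U "J 2" m] J_Suc[of 2] by (simp add: numeral_eq_Suc)
    ultimately show ?thesis
      using J2[OF m] that by auto
  qed
  have ind: "independent {\<theta>1 x, \<theta>2 x}" "independent {\<theta>1 x}" for x
    using \<theta>_independent[of x] by (auto simp: independent_insert)
  have dim0: "dim {0 :: (real^4) \<Rightarrow>\<^sub>L real} = 0"
    using dim_span_eq_card_independent[of "{} :: ((real^4) \<Rightarrow>\<^sub>L real) set"]
    by (simp add: independent_empty)
  have corank: "corank (J 0 m) = 2" "corank (J 1 m) = 3" "b3 m \<noteq> 0 \<Longrightarrow> corank (J 2 m) = 4"
    using dim_span_eq_card_independent[OF ind(1), of m] dim_span_eq_card_independent[OF ind(2), of m]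
      dim0 \<theta>_independent(5)[of m]
    by (auto simp: corank_def J0[OF m] J1[OF m, simplified] J2[OF m])
  have neq: "J 0 m \<noteq> J 1 m" "J 1 m = J 2 m \<longleftrightarrow> b3 m = 0"
  proof -
    show "J 0 m \<noteq> J 1 m"
      using corank by auto
    have "\<theta>1 m \<in> span {\<theta>1 m}"
      by (simp add: span_base)
    then have "span {\<theta>1 m} \<noteq> {0}"
      using \<theta>_independent(3)[of m] by blast
    then show "J 1 m = J 2 m \<longleftrightarrow> b3 m = 0"
      unfolding J1[OF m] J2[OF m] by presburger
  qed
  have sub0: "subbundle_near U (J 0) m"
    unfolding subbundle_near_def
  proof (intro exI conjI ballI allI impI)
    let ?b = "\<lambda>i::nat. if i = 0 then \<theta>1 else \<theta>2"
    have im: "(\<lambda>i. ?b i x) ` {..<2} = {\<theta>1 x, \<theta>2 x}" for x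
      by (auto simp: lessThan_nat_numeral lessThan_Suc numeral_2_eq_2)
    show "smooth_on U (?b i)" for i
      by (simp add: smooth_\<theta>1 smooth_\<theta>2)
    show "inj_on (\<lambda>i. ?b i x) {..<2}" for x
      using \<theta>_independent(5)[of x] by (auto simp: inj_on_def less_2_cases_iff)
    show "independent ((\<lambda>i. ?b i x) ` {..<2})" for x
      unfolding im by (rule ind)
    show "J 0 x = span ((\<lambda>i. ?b i x) ` {..<2})" if "x \<in> U" for x
      unfolding im using that by (rule J0)
  qed (use open_U m in auto)
  have sub1: "subbundle_near U (J 1) m"
    unfolding subbundle_near_def
  proof (intro exI conjI ballI allI impI)
    show "independent ((\<lambda>i::nat. \<theta>1 x) ` {..<1})" for x
      using ind by (simp add: lessThan_Suc)
    show "J 1 x = span ((\<lambda>i::nat. \<theta>1 x) ` {..<1})" if "x \<in> U" for x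
      using J1[OF that] by (simp add: lessThan_Suc)
  qed (use open_U m smooth_\<theta>1 in \<open>auto simp: lessThan_Suc\<close>)
  have sub2: "subbundle_near U (J 2) m" if "b3 m \<noteq> 0"
    unfolding subbundle_near_def
  proof (intro exI conjI ballI allI impI)
    \<comment> \<open>Nonvanishing of \<open>b3\<close> is an open condition, and on this
      neighbourhood the second derived system is the zero bundle, with the empty frame.\<close>
    let ?V = "U \<inter> b3 -` (- {0})"
    have "continuous_on U b3"
      unfolding b3_def by (intro smooth_on_imp_continuous_on smooth_on_frechet_derivative smooth_b)
    then show "open ?V"
      using continuous_open_preimage[OF _ open_U, of b3 "- {0}"] by auto
    show "J 2 x = span ((\<lambda>i::nat. \<theta>1 x) ` {..<0})" if "x \<in> ?V" for x
      using that J2[of x] by simp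
  qed (use m that in \<open>auto simp: independent_empty\<close>)
  have type: "has_type_at U I m cs \<longleftrightarrow> (\<exists>N. (\<forall>k\<le>N. subbundle_near U (J k) m) \<and>
      J N m = J (Suc N) m \<and> (\<forall>k<N. J k m \<noteq> J (Suc k) m) \<and>
      cs = map (\<lambda>k. corank (J k m)) [0..<Suc N])" for cs
    unfolding has_type_at_def J_def Let_def ..
  have Suc: "Suc 1 = 2" "Suc 2 = 3"
    by simp_all
  show "has_type_at U I m [2, 3] \<longleftrightarrow> b3 m = 0"
  proof
    assume "has_type_at U I m [2, 3]"
    then obtain N where N: "J N m = J (Suc N) m" "[2, 3] = map (\<lambda>k. corank (J k m)) [0..<Suc N]"
      unfolding type by (elim exE conjE) (rule that)
    \<comment> \<open>A type has \<open>N + 1\<close> entries, so the length of the list determines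
      \<open>N\<close>.\<close>
    from arg_cong[OF N(2), of length] have "N = 1"
      by simp
    with N(1) show "b3 m = 0"
      using neq(2) Suc(1) by metis
  next
    assume "b3 m = 0"
    then have "J 1 m = J (Suc 1) m"
      using neq(2) Suc(1) by metis
    moreover have "\<forall>k\<le>1. subbundle_near U (J k) m"
      using sub0 sub1 by (auto simp: le_Suc_eq)
    moreover have "\<forall>k<1. J k m \<noteq> J (Suc k) m"
      using neq(1) by simp
    moreover have "[2, 3] = map (\<lambda>k. corank (J k m)) [0..<Suc 1]"
      using corank(1,2) by simp
    ultimately show "has_type_at U I m [2, 3]"
      unfolding type by (intro exI[of _ 1] conjI)
  qed
  show "has_type_at U I m [2, 3, 4] \<longleftrightarrow> b3 m \<noteq> 0"
  proof
    assume "has_type_at U I m [2, 3, 4]"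
    then obtain N where N: "\<forall>k<N. J k m \<noteq> J (Suc k) m"
        "[2, 3, 4] = map (\<lambda>k. corank (J k m)) [0..<Suc N]"
      unfolding type by (elim exE conjE) (rule that)
    from arg_cong[OF N(2), of length] have "N = 2"
      by simp
    with N(1) show "b3 m \<noteq> 0"
      using neq(2) Suc(1) by (metis one_less_numeral_iff semiring_norm(76))
  next
    assume b3: "b3 m \<noteq> 0"
    have "J 2 m = J (Suc 2) m"
      using J3[OF b3] Suc(2) by simp
    moreover have "\<forall>k\<le>2. subbundle_near U (J k) m"
      using sub0 sub1 sub2[OF b3] by (auto simp: le_Suc_eq numeral_2_eq_2)
    moreover have "\<forall>k<2. J k m \<noteq> J (Suc k) m"
      using neq b3 by (simp add: numeral_2_eq_2 All_less_Suc)
    moreover have "[2, 3, 4] = map (\<lambda>k. corank (J k m)) [0..<Suc 2]"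
      using corank(1,2) corank(3)[OF b3] by (simp add: numeral_2_eq_2)
    ultimately show "has_type_at U I m [2, 3, 4]"
      unfolding type by (intro exI[of _ 2] conjI)
  qed
qed

end

section \<open>The reduced system on the leaf space\<close>

text \<open>By Cramer's rule, \<open>b\<close> is a quotient of components of smooth sections.\<close>

lemma smooth_on_if_fibre:
  fixes b :: "real^4 \<Rightarrow> real"
  assumes "open U"
    and "\<And>x. x \<in> U \<Longrightarrow>
      pfaffian_bundle U I x = span {dx 2 + b x *\<^sub>R dx 4, dx 3 - x $ 1 *\<^sub>R dx 4}"
  shows "smooth_on U b"
proof (rule smooth_on_local)
  fix m assume m: "m \<in> U"
  have "dx 2 + b m *\<^sub>R dx 4 \<in> pfaffian_bundle U I m" "dx 3 - m $ 1 *\<^sub>R dx 4 \<in> pfaffian_bundle U I m"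
    by (simp_all add: assms(2)[OF m] span_base)
  \<comment> \<open>These sections agree with the frame only at \<open>m\<close>; elsewhere they are
    unknown combinations of it.\<close>
  then obtain g h where sm: "smooth_on U g" "smooth_on U h"
    and I: "one_form U g \<in> I" "one_form U h \<in> I"
    and gh: "g m = dx 2 + b m *\<^sub>R dx 4" "h m = dx 3 - m $ 1 *\<^sub>R dx 4"
    unfolding pfaffian_bundle_def by (smt (verit) mem_Collect_eq)
  \<comment> \<open>Evaluation at \<open>axis 4 1 + x $ 1 *\<^sub>R axis 3 1\<close> cancels the
    contribution of the second frame form, leaving \<open>b x\<close> times the coefficient of the
    first.\<close>
  have b: "blinfun_apply (\<theta> x) (axis 4 1) + x $ 1 * blinfun_apply (\<theta> x) (axis 3 1) =
      b x * blinfun_apply (\<theta> x) (axis 2 1)"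
    if sec: "one_form U \<theta> \<in> I" "smooth_on U \<theta>" and x: "x \<in> U" for \<theta> x
  proof -
    have "\<theta> x \<in> pfaffian_bundle U I x"
      unfolding pfaffian_bundle_def using sec by blast
    then obtain c d where "\<theta> x = c *\<^sub>R (dx 2 + b x *\<^sub>R dx 4) + d *\<^sub>R (dx 3 - x $ 1 *\<^sub>R dx 4)"
      by (auto simp: assms(2)[OF x] in_span_insert2)
    then show ?thesis
      by (simp add: blinfun.add_left blinfun.diff_left blinfun.scaleR_left axis_def)
  qed
  define g' where "g' i x = blinfun_apply (g x) (axis i 1)" for i x
  define h' where "h' i x = blinfun_apply (h x) (axis i 1)" for i x
  have sm': "smooth_on U (g' i)" "smooth_on U (h' i)" for i
    unfolding g'_def h'_def by (intro smooth_on_apply sm assms(1))+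
  \<comment> \<open>The minor of \<open>g\<close> and \<open>h\<close> in components 2 and 3, equal
    to 1 at \<open>m\<close>. Replacing component 2 by the left side of \<open>b\<close> gives
    \<open>num\<close>, hence \<open>num = b * det\<close>.\<close>
  define det where "det x = g' 2 x * h' 3 x - h' 2 x * g' 3 x" for x
  define num where "num x = (g' 4 x + x $ 1 * g' 3 x) * h' 3 x - (h' 4 x + x $ 1 * h' 3 x) * g' 3 x" for x
  have smdet: "smooth_on U det" and smnum: "smooth_on U num"
    unfolding det_def num_def
    by (intro smooth_on_diff smooth_on_mult smooth_on_add smooth_on_nth sm' assms(1))+
  define V where "V = U \<inter> det -` (- {0})"
  have V: "open V" "V \<subseteq> U"
    unfolding V_def using continuous_open_preimage[OF smooth_on_imp_continuous_on[OF smdet] assms(1)]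
    by auto
  have "det m = 1"
    by (simp add: det_def g'_def h'_def gh blinfun.add_left blinfun.diff_left blinfun.scaleR_left axis_def)
  then have "m \<in> V"
    using m by (simp add: V_def)
  have "num x / det x = b x" if "x \<in> V" for x
  proof -
    have "num x = b x * det x" "det x \<noteq> 0"
      using that b[OF I(1) sm(1)] b[OF I(2) sm(2)]
      by (simp_all add: num_def det_def V_def g'_def h'_def algebra_simps)
    then show ?thesis
      by simp
  qed
  then have "smooth_on V b" if "smooth_on V (\<lambda>x. num x / det x)"
    using smooth_on_cong[OF V(1) _ that] by blast
  moreover have "smooth_on V (\<lambda>x. num x / det x)"
    using V smooth_on_subset[OF smnum] smooth_on_subset[OF smdet]
    by (intro smooth_on_divide) (auto simp: V_def)
  ultimately have "smooth_on V b"
    by blast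
  then show "\<exists>V. open V \<and> m \<in> V \<and> smooth_on V b"
    using V(1) \<open>m \<in> V\<close> by blast
qed

lemma vector_4:
  "vector [a, b, c, d :: 'a::zero] $ (1::4) = a" "vector [a, b, c, d] $ (2::4) = b"
  "vector [a, b, c, d] $ (3::4) = c" "vector [a, b, c, d] $ (4::4) = d"
  unfolding vector_def by simp_all

lemma leaf_coords_simps [simp]:
  "leaf_coords \<alpha> a $ 1 = \<alpha> a" "leaf_coords \<alpha> a $ 2 = a $ 3 - a $ 4 * a $ 1 - a $ 5 * a $ 2"
  "leaf_coords \<alpha> a $ 3 = a $ 4" "leaf_coords \<alpha> a $ 4 = a $ 5"
  by (simp_all add: leaf_coords_def vector_4)

lemma dcoord_apply [simp]: "blinfun_apply (dcoord i) v = v $ i"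
  by (simp add: dcoord_def bounded_linear_Blinfun_apply bounded_linear_vec_nth)

section \<open>The projection to the leaf space as a submersion, and the descent of \<beta>\<close>

locale non_generic_jet =
  fixes D :: "(real^5) set" and \<alpha> :: "real^5 \<Rightarrow> real" and I' :: "(real^4) form set"
  assumes open_D: "open D" and smooth_\<alpha>: "smooth_on D \<alpha>"
    and non_generic: "non_generic_type D \<alpha>"
    and reduced: "reduced_system D (jet_system D \<alpha>) (leaf_coords \<alpha>) I'"
begin

abbreviation f :: "real^5 \<Rightarrow> real^4" where "f \<equiv> leaf_coords \<alpha>"
abbreviation d\<alpha> :: "real^5 \<Rightarrow> real^5 \<Rightarrow> real" where "d\<alpha> a \<equiv> frechet_derivative \<alpha> (at a)"

definition \<beta> :: "real^5 \<Rightarrow> real" where "\<beta> a = a $ 2 + \<alpha> a * a $ 1"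

definition df :: "real^5 \<Rightarrow> real^5 \<Rightarrow> real^4" where
  "df a h = d\<alpha> a h *\<^sub>R axis 1 1 +
     (h $ 3 - (a $ 4 * h $ 1 + h $ 4 * a $ 1) - (a $ 5 * h $ 2 + h $ 5 * a $ 2)) *\<^sub>R axis 2 1 +
     h $ 4 *\<^sub>R axis 3 1 + h $ 5 *\<^sub>R axis 4 1"

lemma df_simps [simp]:
  "df a h $ 1 = d\<alpha> a h"
  "df a h $ 2 = h $ 3 - (a $ 4 * h $ 1 + h $ 4 * a $ 1) - (a $ 5 * h $ 2 + h $ 5 * a $ 2)"
  "df a h $ 3 = h $ 4" "df a h $ 4 = h $ 5"
  by (simp_all add: df_def axis_def)

text \<open>The value of the differential of \<alpha> on the lift of the last three components of
  \<open>w\<close> that has zero \<open>x\<close>- and \<open>y\<close>-components.\<close>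

definition \<kappa> :: "real^5 \<Rightarrow> real^4 \<Rightarrow> real" where
  "\<kappa> a w = pd 3 \<alpha> a * (w $ 2 + a $ 1 * w $ 3 + a $ 2 * w $ 4) + pd 4 \<alpha> a * w $ 3 + pd 5 \<alpha> a * w $ 4"

text \<open>The lift of \<open>w\<close> along \<open>df\<close> without \<open>x\<close>-component; its \<open>y\<close>-component is read off from
  \<open>d\<alpha> v = w $ 1\<close> and the non-genericity of \<open>\<alpha>\<close>.\<close>

definition lift :: "real^5 \<Rightarrow> real^4 \<Rightarrow> real^5" where
  "lift a w = (a $ 1 * (\<kappa> a w - w $ 1)) *\<^sub>R axis 2 1 +
     (w $ 2 + a $ 5 * (a $ 1 * (\<kappa> a w - w $ 1)) + a $ 1 * w $ 3 + a $ 2 * w $ 4) *\<^sub>R axis 3 1 +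
     w $ 3 *\<^sub>R axis 4 1 + w $ 4 *\<^sub>R axis 5 1"

lemma lift_simps [simp]:
  "lift a w $ 1 = 0" "lift a w $ 2 = a $ 1 * (\<kappa> a w - w $ 1)"
  "lift a w $ 3 = w $ 2 + a $ 5 * (a $ 1 * (\<kappa> a w - w $ 1)) + a $ 1 * w $ 3 + a $ 2 * w $ 4"
  "lift a w $ 4 = w $ 3" "lift a w $ 5 = w $ 4"
  by (simp_all add: lift_def axis_def)

lemma \<alpha>_has_derivative: "a \<in> D \<Longrightarrow> (\<alpha> has_derivative d\<alpha> a) (at a)"
  by (rule smooth_on_has_derivative[OF smooth_\<alpha>])

lemma non_generic_eq: "a \<in> D \<Longrightarrow> a $ 1 * (pd 2 \<alpha> a + a $ 5 * pd 3 \<alpha> a) = -1"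
  using non_generic by (fastforce simp: non_generic_type_def)

lemma d\<alpha>_lift:
  assumes "a \<in> D"
  shows "d\<alpha> a (lift a w) = w $ 1"
proof -
  interpret bounded_linear "d\<alpha> a"
    using \<alpha>_has_derivative[OF assms] by (rule has_derivative_bounded_linear)
  \<comment> \<open>The \<open>y\<close>-component also shifts the \<open>z\<close>-component by
    \<open>a $ 5\<close> times itself, so its coefficient is the expression that non-genericity
    fixes at -1.\<close>
  have "d\<alpha> a (lift a w) = (a $ 1 * (pd 2 \<alpha> a + a $ 5 * pd 3 \<alpha> a)) * (\<kappa> a w - w $ 1) + \<kappa> a w"
    unfolding lift_def add scaleR pd_def[symmetric] by (simp add: \<kappa>_def algebra_simps)
  then show ?thesis
    by (simp add: non_generic_eq[OF assms])
qed

lemma df_lift: "a \<in> D \<Longrightarrow> df a (lift a w) = w"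
  by (simp add: vec_eq_iff forall_4 d\<alpha>_lift algebra_simps)

lemma f_has_derivative:
  assumes "a \<in> D"
  shows "(f has_derivative df a) (at a)"
proof -
  have nth: "((\<lambda>a. a $ i) has_derivative (\<lambda>h. h $ i)) (at a)" for i :: 5
    by (rule bounded_linear_imp_has_derivative[OF bounded_linear_vec_nth])
  have "f = (\<lambda>a. \<alpha> a *\<^sub>R axis 1 1 + (a $ 3 - a $ 4 * a $ 1 - a $ 5 * a $ 2) *\<^sub>R axis 2 1 +
      a $ 4 *\<^sub>R axis 3 1 + a $ 5 *\<^sub>R axis 4 1)"
    by (simp add: fun_eq_iff vec_eq_iff forall_4 axis_def)
  then show ?thesis
    unfolding df_def
    by (auto intro!: has_derivative_add has_derivative_diff has_derivative_scaleR_left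
        has_derivative_mult nth \<alpha>_has_derivative[OF assms])
qed

lemma linear_lift: "linear (lift a)"
  by (rule linearI) (simp_all add: lift_def \<kappa>_def vec_eq_iff algebra_simps)

text \<open>The derivative of \<open>f\<close> has the bounded right inverse \<open>lift a\<close>
  at every point, so the open mapping theorem applies.\<close>

lemma open_f_image: "open (f ` D)"
proof -
  have cont: "continuous_on D f"
    using f_has_derivative has_derivative_continuous
    by (blast intro: continuous_at_imp_continuous_on)
  have "f a \<in> interior (f ` D)" if "a \<in> D" for a
  proof (rule sussmann_open_mapping[OF open_D cont that f_has_derivative[OF that]])
    show "bounded_linear (lift a)"
      using linear_lift by (rule linear_conv_bounded_linear[THEN iffD1])
    show "df a \<circ> lift a = id"
      using df_lift[OF that] by auto
  qed (use that open_D in \<open>auto simp: interior_open\<close>)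
  then have "f ` D \<subseteq> interior (f ` D)"
    by blast
  then show ?thesis
    by (simp add: interior_subset open_subset_interior subset_antisym interior_eq[symmetric])
qed

text \<open>Pull-back of covectors is injective because \<open>df a\<close> is surjective.\<close>

lemma eq_if_pullback_eq:
  assumes "a \<in> D" "\<And>v. blinfun_apply e (df a v) = blinfun_apply e' (df a v)"
  shows "e = e'"
  using assms(2)[of "lift a _"] by (intro blinfun_eqI) (simp add: df_lift[OF assms(1)])

text \<open>The differential of \<open>z - p x - q y\<close> is the contact form minus
  \<open>x dp + y dq\<close>. Adding \<open>x (dp - \<alpha> dq)\<close> and
  \<open>\<beta> dq\<close> restores the contact form precisely for
  \<open>\<beta> = y + \<alpha> x\<close>.\<close>

lemma jet_forms_apply:
  "blinfun_apply (dcoord 3 - a $ 4 *\<^sub>R dcoord 1 - a $ 5 *\<^sub>R dcoord 2) v =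
    blinfun_apply ((dx 2 + \<beta> a *\<^sub>R dx 4) + a $ 1 *\<^sub>R (dx 3 - \<alpha> a *\<^sub>R dx 4)) (df a v)"
  "blinfun_apply (dcoord 4 - \<alpha> a *\<^sub>R dcoord 5) v = blinfun_apply (dx 3 - \<alpha> a *\<^sub>R dx 4) (df a v)"
  by (simp_all add: blinfun.add_left blinfun.diff_left blinfun.scaleR_left \<beta>_def algebra_simps)

text \<open>Both inclusions compare degree-1 parts of the two descriptions of the jet ideal at
  \<open>a\<close>, then cancel the pull-back. One starts from the generators of \<open>I'\<close>,
  the other from the two jet forms.\<close>

lemma fibre_\<beta>:
  assumes a: "a \<in> D"
  shows "pfaffian_bundle (f ` D) I' (f a) = span {dx 2 + \<beta> a *\<^sub>R dx 4, dx 3 - \<alpha> a *\<^sub>R dx 4}"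
proof -
  let ?\<omega>0 = "\<lambda>a. dcoord 3 - a $ 4 *\<^sub>R dcoord 1 - a $ 5 *\<^sub>R dcoord 2"
  let ?\<omega>1 = "\<lambda>a. dcoord 4 - \<alpha> a *\<^sub>R dcoord 5"
  let ?\<theta>1 = "dx 2 + \<beta> a *\<^sub>R dx 4 :: (real^4) \<Rightarrow>\<^sub>L real"
  let ?\<theta>2 = "dx 3 - \<alpha> a *\<^sub>R dx 4 :: (real^4) \<Rightarrow>\<^sub>L real"
  obtain T where T: "\<And>\<theta>. \<theta> \<in> T \<Longrightarrow> smooth_on (f ` D) \<theta>"
    and I': "I' = diff_ideal (f ` D) (one_form (f ` D) ` T)"
    using reduced unfolding reduced_system_def pfaffian_system_def by blast
  have jet: "jet_system D \<alpha> = alg_ideal D (pullback D f ` I')"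
    using reduced unfolding reduced_system_def by blast
  have jet': "jet_system D \<alpha> = diff_ideal D (one_form D ` {?\<omega>0, ?\<omega>1})"
    by (simp add: jet_system_def)
  define S where "S = span ((\<lambda>\<theta>. \<theta> (f a)) ` T)"
  have fa: "f a \<in> f ` D"
    using a by blast
  have pb: "pfaffian_bundle (f ` D) I' (f a) = S"
    unfolding I' S_def using pfaffian_bundle_diff_ideal[OF open_f_image T fa] .
  have df: "frechet_derivative f (at a) = df a"
    using frechet_derivative_at[OF f_has_derivative[OF a]] by simp
  have "S \<subseteq> span {?\<theta>1, ?\<theta>2}"
    unfolding S_def
  proof (intro span_minimal subspace_span subsetI)
    fix \<sigma> assume "\<sigma> \<in> (\<lambda>\<theta>. \<theta> (f a)) ` T"
    then obtain \<theta> where \<theta>: "\<theta> \<in> T" "\<sigma> = \<theta> (f a)"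
      by blast
    have "one_form (f ` D) \<theta> \<in> I'"
      using \<theta>(1) by (auto simp: I' diff_ideal_def intro: alg_ideal.gen)
    then have "pullback D f (one_form (f ` D) \<theta>) \<in> diff_ideal D (one_form D ` {?\<omega>0, ?\<omega>1})"
      unfolding jet'[symmetric] jet by (blast intro: alg_ideal.gen)
    then obtain e where e: "e \<in> span ((\<lambda>\<theta>. \<theta> a) ` {?\<omega>0, ?\<omega>1})"
      and pe: "\<And>v. pullback D f (one_form (f ` D) \<theta>) a [v] = blinfun_apply e v"
      using diff_ideal_low_degree[OF _ a] by blast
    obtain c d where "e = c *\<^sub>R ?\<omega>0 a + d *\<^sub>R ?\<omega>1 a"
      using e by (auto simp: in_span_insert2)
    then have ev: "blinfun_apply e v = c * blinfun_apply (?\<omega>0 a) v + d * blinfun_apply (?\<omega>1 a) v" for v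
      by (simp add: blinfun.add_left blinfun.scaleR_left)
    have "blinfun_apply \<sigma> (df a v) = blinfun_apply e v" for v
      using pe[of v] a by (simp add: pullback_def one_form_def df \<theta>(2))
    then have "blinfun_apply \<sigma> (df a v) = blinfun_apply (c *\<^sub>R ?\<theta>1 + (c * a $ 1 + d) *\<^sub>R ?\<theta>2) (df a v)" for v
      unfolding ev jet_forms_apply
      by (simp only: blinfun.add_left blinfun.scaleR_left) (simp add: algebra_simps)
    then show "\<sigma> \<in> span {?\<theta>1, ?\<theta>2}"
      unfolding in_span_insert2 using eq_if_pullback_eq[OF a] by blast
  qed
  moreover have "span {?\<theta>1, ?\<theta>2} \<subseteq> S"
  proof -
    \<comment> \<open>The pull-backs of \<open>S\<close> at \<open>a\<close>: the subspace that
      contains the degree-1 parts of the ideal generated by the pulled-back system.\<close>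
    define P where "P = {e. \<exists>s\<in>S. \<forall>v. blinfun_apply e v = blinfun_apply s (df a v)}"
    have subS: "subspace S"
      by (simp add: S_def)
    have "subspace P"
      unfolding subspace_def
    proof (intro conjI ballI allI)
      show "0 \<in> P"
        using subspace_0[OF subS] by (force simp: P_def)
    next
      fix e e' assume "e \<in> P" "e' \<in> P"
      then obtain s s' where "s \<in> S" "s' \<in> S" "\<And>v. blinfun_apply e v = blinfun_apply s (df a v)"
        "\<And>v. blinfun_apply e' v = blinfun_apply s' (df a v)"
        by (auto simp: P_def)
      then show "e + e' \<in> P"
        using subspace_add[OF subS] by (auto simp: P_def blinfun.add_left intro!: bexI[of _ "s + s'"])
    next
      fix c e assume "e \<in> P"
      then obtain s where "s \<in> S" "\<And>v. blinfun_apply e v = blinfun_apply s (df a v)"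
        by (auto simp: P_def)
      then show "c *\<^sub>R e \<in> P"
        using subspace_scale[OF subS] by (auto simp: P_def blinfun.scaleR_left intro!: bexI[of _ "c *\<^sub>R s"])
    qed
    have low: "\<eta> a [] = 0 \<and> (\<exists>e\<in>P. \<forall>v. \<eta> a [v] = blinfun_apply e v)"
      if "\<eta> \<in> alg_ideal D (pullback D f ` I')" for \<eta>
    proof (rule alg_ideal_low_degree[OF that \<open>subspace P\<close>])
      fix \<omega> assume "\<omega> \<in> pullback D f ` I'"
      then obtain \<zeta> where \<zeta>: "\<zeta> \<in> I'" "\<omega> = pullback D f \<zeta>"
        by blast
      then obtain s where s: "\<zeta> (f a) [] = 0" "s \<in> S" "\<And>v. \<zeta> (f a) [v] = blinfun_apply s v"
        using diff_ideal_low_degree[OF _ fa] unfolding I' S_def by metis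
      define e where "e = blinfun_compose s (Blinfun (df a))"
      have e: "blinfun_apply e v = blinfun_apply s (df a v)" for v
        using f_has_derivative[OF a]
        by (simp add: e_def blinfun_compose.rep_eq bounded_linear_Blinfun_apply has_derivative_bounded_linear)
      have "e \<in> P"
        using e s(2) by (auto simp: P_def)
      with e s show "\<omega> a [] = 0 \<and> (\<exists>e\<in>P. \<forall>v. \<omega> a [v] = blinfun_apply e v)"
        using a by (auto simp: \<zeta>(2) pullback_def df intro!: bexI[of _ e])
    qed
    have S: "\<exists>s\<in>S. \<forall>v. blinfun_apply (\<omega> a) v = blinfun_apply s (df a v)"
      if "\<omega> \<in> {?\<omega>0, ?\<omega>1}" for \<omega>
    proof -
      have "one_form D \<omega> \<in> alg_ideal D (pullback D f ` I')"
        unfolding jet[symmetric] jet' diff_ideal_def using that by (intro alg_ideal.gen) blast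
      from low[OF this] show ?thesis
        using a by (auto simp: one_form_def P_def)
    qed
    have 0: "?\<theta>1 + a $ 1 *\<^sub>R ?\<theta>2 \<in> S"
      using S[of ?\<omega>0] eq_if_pullback_eq[OF a] unfolding jet_forms_apply by blast
    have 1: "?\<theta>2 \<in> S"
      using S[of ?\<omega>1] eq_if_pullback_eq[OF a] unfolding jet_forms_apply by blast
    \<comment> \<open>The contact form yields only a combination with \<open>?\<theta>2\<close>,
      whose multiple by \<open>a $ 1\<close> is subtracted.\<close>
    have "?\<theta>1 \<in> S"
      using subspace_diff[OF subS 0 subspace_scale[OF subS 1, of "a $ 1"]] by simp
    with 1 show ?thesis
      using subS by (intro span_minimal) auto
  qed
  ultimately show ?thesis
    using pb by blast
qed

text \<open>The function \<beta> read at an arbitrarily chosen point over \<open>m\<close>; the next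
  lemma shows independence of the choice.\<close>

definition \<beta>bar :: "real^4 \<Rightarrow> real" where
  "\<beta>bar m = \<beta> (SOME a. a \<in> D \<and> f a = m)"

text \<open>The fibre of \<open>I'\<close> depends only on the image point, and it determines
  \<beta> through \<open>fibre_\<beta>\<close>.\<close>

lemma \<beta>bar:
  assumes a: "a \<in> D"
  shows "\<beta>bar (f a) = \<beta> a"
proof -
  define a' where "a' = (SOME a'. a' \<in> D \<and> f a' = f a)"
  have a': "a' \<in> D" "f a' = f a"
    using someI[of "\<lambda>a'. a' \<in> D \<and> f a' = f a" a] a by (auto simp: a'_def)
  have "\<alpha> a' = \<alpha> a"
    using arg_cong[OF a'(2), of "\<lambda>m. m $ 1"] by simp
  then have "dx 2 + \<beta> a' *\<^sub>R dx 4 \<in> span {dx 2 + \<beta> a *\<^sub>R dx 4, dx 3 - \<alpha> a *\<^sub>R dx 4 :: (real^4) \<Rightarrow>\<^sub>L real}"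
    using fibre_\<beta>[OF a] fibre_\<beta>[OF a'(1)] a'(2) by (auto intro: span_base)
  then obtain c d where eq: "dx 2 + \<beta> a' *\<^sub>R dx 4 =
      c *\<^sub>R (dx 2 + \<beta> a *\<^sub>R dx 4) + d *\<^sub>R (dx 3 - \<alpha> a *\<^sub>R dx 4 :: (real^4) \<Rightarrow>\<^sub>L real)"
    unfolding in_span_insert2 by blast
  have "v $ 2 + \<beta> a' * v $ 4 = c * (v $ 2 + \<beta> a * v $ 4) + d * (v $ 3 - \<alpha> a * v $ 4)" for v :: "real^4"
    using arg_cong[OF eq, of "\<lambda>e. blinfun_apply e v"]
    by (simp add: blinfun.add_left blinfun.diff_left blinfun.scaleR_left)
  \<comment> \<open>The three evaluations give \<open>c = 1\<close>, \<open>d = 0\<close>, and then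
    equality of the two values of \<beta>.\<close>
  from this[of "axis 2 1"] this[of "axis 3 1"] this[of "axis 4 1"] show ?thesis
    by (simp add: axis_def \<beta>bar_def a'_def)
qed

lemma fibre_\<beta>bar:
  assumes "m \<in> f ` D"
  shows "pfaffian_bundle (f ` D) I' m = span {dx 2 + \<beta>bar m *\<^sub>R dx 4, dx 3 - m $ 1 *\<^sub>R dx 4}"
  using assms fibre_\<beta> \<beta>bar by auto

text \<open>The chain rule for \<open>\<beta> = \<beta>bar \<circ> f\<close> is evaluated on
  \<open>lift a w\<close>. This lift has no \<open>x\<close>-component, and the two terms in
  \<open>w $ 1\<close> cancel.\<close>

lemma \<beta>bar_deriv:
  assumes a: "a \<in> D"
  shows "frechet_derivative \<beta>bar (at (f a)) w = a $ 1 * \<kappa> a w"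
proof -
  define db where "db = frechet_derivative \<beta>bar (at (f a))"
  have "smooth_on (f ` D) \<beta>bar"
    by (rule smooth_on_if_fibre[OF open_f_image fibre_\<beta>bar])
  then have "(\<beta>bar has_derivative db) (at (f a))"
    unfolding db_def using a by (intro smooth_on_has_derivative) auto
  then have "(\<beta>bar \<circ> f has_derivative db \<circ> df a) (at a)"
    by (rule diff_chain_at[OF f_has_derivative[OF a]])
  then have "(\<beta> has_derivative db \<circ> df a) (at a)"
    by (rule has_derivative_transform_within_open[OF _ open_D a]) (simp add: \<beta>bar)
  moreover have "(\<beta> has_derivative (\<lambda>h. h $ 2 + (\<alpha> a * h $ 1 + d\<alpha> a h * a $ 1))) (at a)"
    unfolding \<beta>_def
    by (intro has_derivative_add has_derivative_mult \<alpha>_has_derivative[OF a]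
        bounded_linear_imp_has_derivative[OF bounded_linear_vec_nth])
  ultimately have "db \<circ> df a = (\<lambda>h. h $ 2 + (\<alpha> a * h $ 1 + d\<alpha> a h * a $ 1))"
    by (rule has_derivative_unique)
  from fun_cong[OF this, of "lift a w"] show ?thesis
    by (simp add: db_def df_lift[OF a] d\<alpha>_lift[OF a] algebra_simps)
qed

sublocale reduced_pfaffian "f ` D" I' \<beta>bar
proof
  show "smooth_on (f ` D) \<beta>bar"
    by (rule smooth_on_if_fibre[OF open_f_image fibre_\<beta>bar])
  \<comment> \<open>The first component of \<open>w\<close> does not occur in
    \<open>\<kappa> a w\<close>.\<close>
  show "frechet_derivative \<beta>bar (at m) (axis 1 1) = 0" if "m \<in> f ` D" for m
    using that \<beta>bar_deriv by (auto simp: \<kappa>_def axis_def)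
qed (use open_f_image fibre_\<beta>bar in auto)

text \<open>On the third coordinate vector \<kappa> is the quantity of the theorem, and
  non-genericity makes its factor \<open>a $ 1\<close> nonzero.\<close>

lemma b3_eq_0_iff:
  assumes a: "a \<in> D"
  shows "b3 (f a) = 0 \<longleftrightarrow> pd 4 \<alpha> a + a $ 1 * pd 3 \<alpha> a = 0"
proof -
  have "a $ 1 \<noteq> 0"
    using non_generic_eq[OF a] by auto
  moreover have "b3 (f a) = a $ 1 * (pd 4 \<alpha> a + a $ 1 * pd 3 \<alpha> a)"
    by (simp add: b3_def \<beta>bar_deriv[OF a] \<kappa>_def axis_def algebra_simps)
  ultimately show ?thesis
    by simp
qed

end

theorem theorem5p10:
  fixes D :: "(real^5) set" and \<alpha> :: "real^5 \<Rightarrow> real" and p0 :: "real^5"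
    and I' :: "(real^4) form set"
  assumes "open D" and "p0 \<in> D"
    and "smooth_on D \<alpha>"
    and "involutive_type D \<alpha>" and "non_generic_type D \<alpha>"
    and "leaf_projection D (jet_system D \<alpha>) (leaf_coords \<alpha>)"
    and "reduced_system D (jet_system D \<alpha>) (leaf_coords \<alpha>) I'"
  shows "(has_type_at (leaf_coords \<alpha> ` D) I' (leaf_coords \<alpha> p0) [2, 3] \<longleftrightarrow>
            pd 4 \<alpha> p0 + p0 $ 1 * pd 3 \<alpha> p0 = 0) \<and>
         (has_type_at (leaf_coords \<alpha> ` D) I' (leaf_coords \<alpha> p0) [2, 3, 4] \<longleftrightarrow>
            pd 4 \<alpha> p0 + p0 $ 1 * pd 3 \<alpha> p0 \<noteq> 0)"
proof -
  interpret non_generic_jet D \<alpha> I'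
    using assms by unfold_locales
  show ?thesis
    using type_iff[of "f p0"] b3_eq_0_iff[OF assms(2)] assms(2) by simp
qed

end
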